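(* Let $Z=(T_i,U_i)_{i\ge 1}$ be a marked point process with marks in $\mathbb{R}^d$ on a filtered probability space $(\Omega,\mathcal{F},\mathbb{F},\mathbb{P})$, let $\mu$ be its associated integer-valued random measure and $\nu$ the $\mathbb{F}$-compensator of $\mu$. Let $G:\mathbb{R}_+\times\mathbb{R}^d\to\mathbb{R}$ be measurable and let $S_t=\sum_{i\ge1}\mathbf{1}_{\{T_i\le t\}}G(t-T_i,U_i)$, $t\ge0$, be the corresponding shot-noise process. Assume that $\nu(dt,dx)$ does not depend on $\omega$ and that $\nu([0,T],\mathbb{R}^d)<\infty$. Then, for any $0\le t\le T$ and $\theta\in\mathbb{R}$, $$\mathbb{E}\big[e^{i\theta S_T}\,\big|\,\mathcal{F}_t\big]=\exp\Big(i\theta\int_0^t\int_{\mathbb{R}^d}G(T-s,x)\,\mu(ds,dx)\Big)\cdot\exp\Big(\int_t^T\int_{\mathbb{R}^d}\big(e^{i\theta G(T-s,x)}-1\big)\,\nu(ds,dx)\Big).$$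
   Context: The filtration $\mathbb{F}=(\mathcal{F}_t)_{t\ge0}$ satisfies the usual conditions. A marked point process $Z=(T_i,U_i)_{i\ge1}$ consists of an increasing sequence of stopping times $0<T_1<T_2<\dots$ and a sequence of $\mathbb{R}^d$-valued random variables $U_1,U_2,\dots$. The associated integer-valued random measure $\mu$ on $\mathbb{R}_+\times\mathbb{R}^d$ is given by $\mu([0,t]\times A)=\sum_{i\ge1}\mathbf{1}_{\{U_i\in A\}}\mathbf{1}_{\{T_i\le t\}}$ for $t\ge0$ and Borel $A\subset\mathbb{R}^d$. A shot-noise process is a process of the form $S_t=\sum_{i\ge1}\mathbf{1}_{\{T_i\le t\}}G(t-T_i,U_i)=\int_0^t\int_{\mathbb{R}^d}G(t-s,x)\,\mu(ds,dx)$, $t\ge0$, where absolute convergence of the sum is implicitly assumed. The compensator $\nu$ of $\mu$ is the unique $\mathbb{F}$-predictable random measure such that $\mathbb{E}[\int_{[0,\infty)\times\mathbb{R}^d}W\,d\mu]=\mathbb{E}[\int_{[0,\infty)\times\mathbb{R}^d}W\,d\nu]$ for every non-negative $\mathcal{P}\otimes\mathcal{B}(\mathbb{R}^d)$-measurable function $W$ on $\Omega\times\mathbb{R}_{\ge0}\times\mathbb{R}^d$, where $\mathcal{P}$ is the predictable $\sigma$-field.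
   Formalization: Added: ν({s}×R^d)=0 for every s in (t,T] (no fixed jump times), since the formula fails for T_i=i, G=1, t=0, T=1: e^{iθ} versus exp(e^{iθ}−1). Marks U_i are taken F_{T_i}-measurable, as is usual for marked point processes. *)

theory Defs
  imports "HOL-Probability.Probability"
begin

(* The filtration is indexed by all reals because the library notions filtration, stopping_time
   and pre_sigma need an index type.  Only the times t >= 0 carry content: a filtration
   on [0,oo) extends to the negative times by F t = F 0. *)
locale usual_filtered_prob_space = prob_space M + filtration "space M" F
  for M :: "'a measure" and F :: "real \<Rightarrow> 'a measure" +
  assumes sub_F: "\<And>t. 0 \<le> t \<Longrightarrow> sets (F t) \<subseteq> sets M"
    and right_continuous_F: "\<And>t. 0 \<le> t \<Longrightarrow> (\<Inter>s\<in>{t<..}. sets (F s)) = sets (F t)"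
    and complete_F: "\<And>N A. N \<in> null_sets M \<Longrightarrow> A \<subseteq> N \<Longrightarrow> A \<in> sets (F 0)"

definition time_marks :: "(real \<times> (real ^ 'd)) measure" where
  "time_marks = restrict_space borel ({0..} \<times> UNIV)"

(* The points are enumerated from 0 instead of 1.  The mark U i has to be known at time T i,
   i.e. to be measurable with respect to the sigma-field of T i; equivalently, the random measure
   of the point process is adapted.  The points may accumulate at a finite time. *)
definition marked_point_process ::
  "'a measure \<Rightarrow> (real \<Rightarrow> 'a measure) \<Rightarrow> (nat \<Rightarrow> 'a \<Rightarrow> real) \<Rightarrow> (nat \<Rightarrow> 'a \<Rightarrow> real ^ 'd) \<Rightarrow> bool"
where
  "marked_point_process M F T U \<longleftrightarrow>
     (\<forall>i. stopping_time F (T i)) \<and>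
     (\<forall>\<omega>\<in>space M. 0 < T 0 \<omega> \<and> (\<forall>i. T i \<omega> < T (Suc i) \<omega>)) \<and>
     (\<forall>i. U i \<in> borel_measurable (filtration.pre_sigma (space M) F (T i)))"

(* The counting measure of the points (T i, U i), i.e. the sum of the Dirac measures at them. *)
definition jump_measure ::
  "(nat \<Rightarrow> 'a \<Rightarrow> real) \<Rightarrow> (nat \<Rightarrow> 'a \<Rightarrow> real ^ 'd) \<Rightarrow> 'a \<Rightarrow> (real \<times> (real ^ 'd)) measure"
where
  "jump_measure T U \<omega> = distr (count_space UNIV) time_marks (\<lambda>i. (T i \<omega>, U i \<omega>))"

lemma emeasure_jump_measure:
  fixes U :: "nat \<Rightarrow> 'a \<Rightarrow> real ^ 'd"
  assumes mpp: "marked_point_process M F T U" and \<omega>: "\<omega> \<in> space M"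
    and A: "A \<in> sets borel" and t: "0 \<le> t"
  shows "emeasure (jump_measure T U \<omega>) ({0..t} \<times> A) =
    (\<Sum>i. indicator A (U i \<omega>) * indicator {..t} (T i \<omega>))"
proof -
  have pos: "0 < T i \<omega>" for i
    using mpp \<omega> by (induction i) (auto simp: marked_point_process_def intro: less_trans)
  have meas: "(\<lambda>i. (T i \<omega>, U i \<omega>)) \<in> count_space UNIV \<rightarrow>\<^sub>M (time_marks :: (real \<times> (real ^ 'd)) measure)"
    using pos by (auto simp: time_marks_def space_restrict_space less_imp_le)
  have "{0..t} \<times> A \<in> sets (borel :: (real \<times> (real ^ 'd)) measure)"
    using A by (auto simp: borel_prod[symmetric])
  then have sets: "{0..t} \<times> A \<in> sets (time_marks :: (real \<times> (real ^ 'd)) measure)"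
    by (auto simp: time_marks_def sets_restrict_space intro!: image_eqI[where x="{0..t} \<times> A"])
  have "emeasure (jump_measure T U \<omega>) ({0..t} \<times> A) =
      (\<integral>\<^sup>+z. indicator ({0..t} \<times> A) z \<partial>jump_measure T U \<omega>)"
    using sets by (simp add: jump_measure_def)
  also have "\<dots> = (\<integral>\<^sup>+i. indicator ({0..t} \<times> A) (T i \<omega>, U i \<omega>) \<partial>count_space UNIV)"
    using meas sets unfolding jump_measure_def by (subst nn_integral_distr) auto
  also have "\<dots> = (\<Sum>i. indicator ({0..t} \<times> A) (T i \<omega>, U i \<omega>))"
    by (rule nn_integral_count_space_nat)
  also have "\<dots> = (\<Sum>i. indicator A (U i \<omega>) * indicator {..t} (T i \<omega>))"
    using pos by (intro suminf_cong) (auto simp: indicator_def less_imp_le)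
  finally show ?thesis .
qed

definition shot_noise ::
  "(real \<Rightarrow> real ^ 'd \<Rightarrow> real) \<Rightarrow> (nat \<Rightarrow> 'a \<Rightarrow> real) \<Rightarrow> (nat \<Rightarrow> 'a \<Rightarrow> real ^ 'd) \<Rightarrow> real \<Rightarrow> 'a \<Rightarrow> real"
where
  "shot_noise G T U t \<omega> = (\<Sum>i. indicator {..t} (T i \<omega>) * G (t - T i \<omega>) (U i \<omega>))"

definition shot_noise_converges ::
  "'a measure \<Rightarrow> (real \<Rightarrow> real ^ 'd \<Rightarrow> real) \<Rightarrow> (nat \<Rightarrow> 'a \<Rightarrow> real) \<Rightarrow> (nat \<Rightarrow> 'a \<Rightarrow> real ^ 'd) \<Rightarrow> bool"
where
  "shot_noise_converges M G T U \<longleftrightarrow> (AE \<omega> in M. \<forall>t\<ge>0.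
     summable (\<lambda>i. \<bar>indicator {..t} (T i \<omega>) * G (t - T i \<omega>) (U i \<omega>)\<bar>))"

(* The sigma-field on Omega x [0,oo) generated by the predictable rectangles. *)
definition predictable_sigma :: "'a measure \<Rightarrow> (real \<Rightarrow> 'a measure) \<Rightarrow> ('a \<times> real) measure" where
  "predictable_sigma M F = sigma (space M \<times> {0..})
     ({A \<times> {0} |A. A \<in> sets (F 0)} \<union>
      {A \<times> {s<..t} |A s t. 0 \<le> s \<and> s < t \<and> A \<in> sets (F s)})"

(* A random measure is predictable if integrating a non-negative predictable function over
   [0,t] x R^d always yields a predictable process in t. *)
definition predictable_random_measure ::
  "'a measure \<Rightarrow> (real \<Rightarrow> 'a measure) \<Rightarrow> ('a \<Rightarrow> (real \<times> (real ^ 'd)) measure) \<Rightarrow> bool"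
where
  "predictable_random_measure M F \<nu> \<longleftrightarrow>
     (\<forall>\<omega>\<in>space M. sets (\<nu> \<omega>) = sets time_marks) \<and>
     (\<forall>W :: ('a \<times> real) \<times> (real ^ 'd) \<Rightarrow> ennreal.
        W \<in> borel_measurable (predictable_sigma M F \<Otimes>\<^sub>M borel) \<longrightarrow>
        (\<lambda>(\<omega>, t). \<integral>\<^sup>+(s, x). W ((\<omega>, s), x) * indicator {0..t} s \<partial>\<nu> \<omega>)
          \<in> borel_measurable (predictable_sigma M F))"

definition compensator ::
  "'a measure \<Rightarrow> (real \<Rightarrow> 'a measure) \<Rightarrow> ('a \<Rightarrow> (real \<times> (real ^ 'd)) measure) \<Rightarrow>
   ('a \<Rightarrow> (real \<times> (real ^ 'd)) measure) \<Rightarrow> bool"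
where
  "compensator M F \<mu> \<nu> \<longleftrightarrow>
     predictable_random_measure M F \<nu> \<and>
     (\<forall>W :: ('a \<times> real) \<times> (real ^ 'd) \<Rightarrow> ennreal.
        W \<in> borel_measurable (predictable_sigma M F \<Otimes>\<^sub>M borel) \<longrightarrow>
        (\<integral>\<^sup>+\<omega>. (\<integral>\<^sup>+(s, x). W ((\<omega>, s), x) \<partial>\<mu> \<omega>) \<partial>M) =
        (\<integral>\<^sup>+\<omega>. (\<integral>\<^sup>+(s, x). W ((\<omega>, s), x) \<partial>\<nu> \<omega>) \<partial>M))"

definition complex_cond_exp :: "'a measure \<Rightarrow> 'a measure \<Rightarrow> ('a \<Rightarrow> complex) \<Rightarrow> 'a \<Rightarrow> complex" where
  "complex_cond_exp M N f \<omega> =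
     Complex (real_cond_exp M N (\<lambda>\<omega>. Re (f \<omega>)) \<omega>) (real_cond_exp M N (\<lambda>\<omega>. Im (f \<omega>)) \<omega>)"

end

theory Submission
  imports Defs
begin

text \<open>
  Let \<open>V u\<close> be \<open>exp\<close> of \<open>\<i>\<theta>\<close> times the sum of \<open>G (H - T k) (U k)\<close> over the points with \<open>T k \<le> u\<close>,
  let \<open>f (s, x) = exp (\<i> * \<theta> * G (H - s) x) - 1\<close> and let \<open>\<Lambda> u v\<close> be the integral of \<open>f\<close> over
  \<open>{u<..v} \<times> UNIV\<close> with respect to the deterministic compensator.  On a window \<open>{u<..v}\<close> the ratio
  \<open>V v / V u\<close> is the product of the factors \<open>1 + f (T k, U k)\<close>, which differs from
  \<open>1 + (\<Sum>k. f (T k, U k))\<close> by at most four times the number of pairs of points in the window.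
  The compensation formula shows that \<open>\<Sum>k. f (T k, U k)\<close> has conditional mean \<open>\<Lambda> u v\<close> given \<open>F u\<close>, and,
  applied to the predictable count of earlier points, that the expected number of pairs is at most the
  squared mass of the window.  Hence, for \<open>A \<in> F t\<close>, the function \<open>u \<mapsto> E (1\<^sub>A * V u) * exp (\<Lambda> u H)\<close>
  varies over a window by at most a constant times its squared mass.  As there are no fixed atoms
  after \<open>t\<close>, cutting \<open>{t<..H}\<close> into \<open>n\<close> windows of equal mass and letting \<open>n\<close> grow shows that this function
  is constant.
\<close>

section \<open>Two analytic estimates and a constancy criterion\<close>

lemma norm_exp_minus_one_minus_le: "norm (exp z - 1 - z) \<le> exp \<bar>Re z\<bar> * (norm z)\<^sup>2" for z :: complex
  using Taylor_exp[of z 1] by (simp add: diff_diff_eq power2_eq_square)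

text \<open>Adjoining a new largest index \<open>b\<close> changes the error by \<open>f b\<close>
  times the old product minus one. All factors have modulus one, so \<open>f b\<close> has norm at
  most 2 and the product minus one at most 2 per earlier index. The new error is thus at most 4 for
  every pair whose larger member is \<open>b\<close>.\<close>

lemma norm_prod_one_plus_le:
  fixes f :: "'i::linorder \<Rightarrow> complex"
  assumes A: "finite A" and f: "\<And>i. i \<in> A \<Longrightarrow> norm (1 + f i) = 1"
  shows "norm ((\<Prod>i\<in>A. 1 + f i) - 1 - (\<Sum>i\<in>A. f i)) \<le> 4 * real (\<Sum>j\<in>A. card {i\<in>A. i < j})"
  using A f
proof (induction rule: finite_linorder_max_induct)
  case (insert b A)
  have fb: "norm (f b) \<le> 2"
    using norm_triangle_ineq4[of "1 + f b" 1] insert.prems by auto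
  \<comment> \<open>A product of unit numbers lies within 2 of one, and the empty product equals
    one; the factor \<open>card A\<close> covers both cases.\<close>
  have P: "norm ((\<Prod>i\<in>A. 1 + f i) - 1) \<le> 2 * real (card A)"
  proof (cases "A = {}")
    case False
    have "norm (\<Prod>i\<in>A. 1 + f i) = 1"
      using insert.prems by (simp add: prod_norm[symmetric])
    then have "norm ((\<Prod>i\<in>A. 1 + f i) - 1) \<le> 2"
      using norm_triangle_ineq4[of "\<Prod>i\<in>A. 1 + f i" 1] by simp
    moreover have "card A \<ge> 1"
      using False insert.hyps by (simp add: Suc_le_eq card_gt_0_iff)
    ultimately show ?thesis by simp
  qed simp
  have b: "b \<notin> A"
    using insert.hyps by auto
  have "(\<Prod>i\<in>insert b A. 1 + f i) - 1 - (\<Sum>i\<in>insert b A. f i) =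
      ((\<Prod>i\<in>A. 1 + f i) - 1 - (\<Sum>i\<in>A. f i)) + f b * ((\<Prod>i\<in>A. 1 + f i) - 1)"
    using b insert.hyps by (simp add: algebra_simps)
  then have "norm ((\<Prod>i\<in>insert b A. 1 + f i) - 1 - (\<Sum>i\<in>insert b A. f i)) \<le>
      norm ((\<Prod>i\<in>A. 1 + f i) - 1 - (\<Sum>i\<in>A. f i)) + norm (f b) * norm ((\<Prod>i\<in>A. 1 + f i) - 1)"
    by (metis norm_mult norm_triangle_ineq)
  also have "\<dots> \<le> 4 * real (\<Sum>j\<in>A. card {i\<in>A. i < j}) + 2 * (2 * real (card A))"
    using insert by (intro add_mono mult_mono fb P) auto
  also have "\<dots> = 4 * real (\<Sum>j\<in>insert b A. card {i\<in>insert b A. i < j})"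
  proof -
    have "{i \<in> insert b A. i < b} = A" "\<And>j. j \<in> A \<Longrightarrow> {i \<in> insert b A. i < j} = {i \<in> A. i < j}"
      using insert.hyps by force+
    then show ?thesis
      using b insert.hyps by (simp cong: sum.cong)
  qed
  finally show ?case .
qed simp

text \<open>Continuity of \<open>m\<close> allows cutting the interval into \<open>Suc n\<close>
  pieces along which \<open>m\<close> grows by equal amounts. Each piece contributes a constant
  times the square of 1 / \<open>Suc n\<close>, so the total is of order 1 / \<open>Suc n\<close>
  and vanishes in the limit. Cutting by the value of \<open>m\<close> instead of by time avoids any
  rate of continuity.\<close>

lemma constant_if_quadratic_modulus:
  fixes \<Phi> :: "real \<Rightarrow> 'b::real_normed_vector" and m :: "real \<Rightarrow> real"
  assumes ab: "a \<le> b" and m: "continuous_on {a..b} m" and mab: "m a \<le> m b"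
    and \<Phi>: "\<And>u v. a \<le> u \<Longrightarrow> u \<le> v \<Longrightarrow> v \<le> b \<Longrightarrow> norm (\<Phi> v - \<Phi> u) \<le> C * (m v - m u)\<^sup>2"
  shows "\<Phi> b = \<Phi> a"
proof -
  \<comment> \<open>As \<open>m\<close> may fail to be monotone, the nodes supplied by the
    intermediate value theorem may be out of order; hence the bound in symmetric form.\<close>
  have \<Phi>': "norm (\<Phi> v - \<Phi> u) \<le> C * (m v - m u)\<^sup>2" if "u \<in> {a..b}" "v \<in> {a..b}" for u v
    using \<Phi>[of u v] \<Phi>[of v u] that by (cases "u \<le> v") (auto simp: norm_minus_commute power2_commute)
  have "norm (\<Phi> b - \<Phi> a) \<le> (C * (m b - m a)\<^sup>2) / real (Suc n)" for n
  proof -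
    let ?y = "\<lambda>k. m a + real k / real (Suc n) * (m b - m a)"
    \<comment> \<open>The end nodes are pinned to \<open>a\<close> and \<open>b\<close>, because
      \<open>m\<close> may take its end values elsewhere as well.\<close>
    have "\<exists>x. x \<in> {a..b} \<and> m x = ?y k \<and> (k = 0 \<longrightarrow> x = a) \<and> (k = Suc n \<longrightarrow> x = b)" if "k \<le> Suc n" for k
    proof (cases "k = 0 \<or> k = Suc n")
      case False
      have "real k / real (Suc n) * (m b - m a) \<le> 1 * (m b - m a)"
        using mab that by (intro mult_right_mono) auto
      then have "\<exists>x\<ge>a. x \<le> b \<and> m x = ?y k"
        using mab by (intro IVT'[OF _ _ ab m]) auto
      then show ?thesis using False by auto
    qed (use ab in auto)
    then obtain x where x: "\<And>k. k \<le> Suc n \<Longrightarrow> x k \<in> {a..b} \<and> m (x k) = ?y k \<and> (k = 0 \<longrightarrow> x k = a) \<and> (k = Suc n \<longrightarrow> x k = b)"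
      by metis
    have "\<Phi> b - \<Phi> a = (\<Sum>k<Suc n. \<Phi> (x (Suc k)) - \<Phi> (x k))"
      using x[of 0] x[of "Suc n"] by (subst sum_lessThan_telescope) auto
    also have "norm \<dots> \<le> (\<Sum>k<Suc n. C * (((m b - m a) / real (Suc n))\<^sup>2))"
    proof (intro sum_norm_le)
      fix k assume k: "k \<in> {..<Suc n}"
      have "m (x (Suc k)) - m (x k) = (m b - m a) / real (Suc n)"
      proof -
        have "m (x (Suc k)) = ?y (Suc k)" "m (x k) = ?y k"
          using x[of k] x[of "Suc k"] k by auto
        then show ?thesis by (simp add: field_simps)
      qed
      then show "norm (\<Phi> (x (Suc k)) - \<Phi> (x k)) \<le> C * (((m b - m a) / real (Suc n))\<^sup>2)"
        using \<Phi>'[of "x k" "x (Suc k)"] x[of k] x[of "Suc k"] k by auto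
    qed
    also have "\<dots> = (C * (m b - m a)\<^sup>2) / real (Suc n)"
      by (simp add: power2_eq_square)
    finally show ?thesis .
  qed
  moreover have "(\<lambda>n. (C * (m b - m a)\<^sup>2) / real (Suc n)) \<longlonglongrightarrow> 0"
    by (rule LIMSEQ_Suc[OF lim_const_over_n])
  ultimately have "norm (\<Phi> b - \<Phi> a) \<le> 0"
    by (intro LIMSEQ_le_const) auto
  then show ?thesis by simp
qed

lemma norm_iexp_minus_one_le: "norm (exp (\<i> * complex_of_real x) - 1) \<le> 2"
  using norm_triangle_ineq4[of "exp (\<i> * complex_of_real x)" 1] by simp

section \<open>The space of times and marks\<close>

lemma space_time_marks: "space (time_marks :: (real \<times> (real ^ 'd)) measure) = {0..} \<times> UNIV"
  by (simp add: time_marks_def space_restrict_space)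

lemma measurable_fst_time_marks[measurable]:
  "fst \<in> (time_marks :: (real \<times> (real ^ 'd)) measure) \<rightarrow>\<^sub>M borel"
proof -
  have "fst \<in> borel_measurable (borel :: (real \<times> (real ^ 'd)) measure)"
    by (simp add: borel_prod[symmetric])
  then show ?thesis
    unfolding time_marks_def by (rule measurable_restrict_space1)
qed

lemma measurable_snd_time_marks[measurable]:
  "snd \<in> (time_marks :: (real \<times> (real ^ 'd)) measure) \<rightarrow>\<^sub>M borel"
proof -
  have "snd \<in> borel_measurable (borel :: (real \<times> (real ^ 'd)) measure)"
    by (simp add: borel_prod[symmetric])
  then show ?thesis
    unfolding time_marks_def by (rule measurable_restrict_space1)
qed

lemma indicator_window: "indicator {u<..v} (fst z) = indicator ({u<..v} \<times> UNIV) z"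
  by (cases z) (auto simp: indicator_def)

lemma time_reversal_measurable:
  fixes G :: "real \<Rightarrow> real ^ 'd \<Rightarrow> real"
  assumes G: "(\<lambda>(s, x). G s x) \<in> borel_measurable time_marks"
  shows "(\<lambda>z. if fst z \<le> H then G (H - fst z) (snd z) else 0) \<in> borel_measurable time_marks"
proof -
  \<comment> \<open>\<open>G\<close> is measurable on non-negative times only, so the reversed time
    is clamped at 0 before \<open>G\<close> is applied. Where the clamping has an effect, the cutoff
    at \<open>H\<close> returns 0.\<close>
  let ?r = "\<lambda>z :: real \<times> (real ^ 'd). (max 0 (H - fst z), snd z)"
  have "?r \<in> (time_marks :: (real \<times> (real ^ 'd)) measure) \<rightarrow>\<^sub>M borel \<Otimes>\<^sub>M borel"
    by measurable
  then have "?r \<in> time_marks \<rightarrow>\<^sub>M (time_marks :: (real \<times> (real ^ 'd)) measure)"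
    by (subst (2) time_marks_def, intro measurable_restrict_space2) (auto simp: borel_prod)
  from measurable_compose[OF this G]
  have [measurable]: "(\<lambda>z. G (max 0 (H - fst z)) (snd z)) \<in> borel_measurable time_marks"
    by simp
  have "(\<lambda>z. if fst z \<le> H then G (max 0 (H - fst z)) (snd z) else 0) \<in>
      borel_measurable (time_marks :: (real \<times> (real ^ 'd)) measure)"
    by measurable
  moreover have "(if fst z \<le> H then G (max 0 (H - fst z)) (snd z) else 0) =
      (if fst z \<le> H then G (H - fst z) (snd z) else 0)" for z :: "real \<times> (real ^ 'd)"
    by simp
  ultimately show ?thesis
    by simp
qed

section \<open>Predictable integrands and the compensation formula\<close>

text \<open>A compensator that is the same for every outcome enters as one fixed measure
  \<open>\<nu>\<^sub>0\<close>. The horizon is called \<open>H\<close> because \<open>T\<close>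
  names the jump times.\<close>

locale deterministic_compensator = usual_filtered_prob_space M F
  for M :: "'a measure" and F :: "real \<Rightarrow> 'a measure" +
  fixes T :: "nat \<Rightarrow> 'a \<Rightarrow> real" and U :: "nat \<Rightarrow> 'a \<Rightarrow> real ^ 'd"
    and \<nu>\<^sub>0 :: "(real \<times> (real ^ 'd)) measure" and H :: real
  assumes mpp: "marked_point_process M F T U"
    and sets_\<nu>\<^sub>0: "sets \<nu>\<^sub>0 = sets time_marks"
    and compensation: "\<And>W :: ('a \<times> real) \<times> (real ^ 'd) \<Rightarrow> ennreal.
      W \<in> borel_measurable (predictable_sigma M F \<Otimes>\<^sub>M borel) \<Longrightarrow>
      (\<integral>\<^sup>+\<omega>. (\<integral>\<^sup>+(s, x). W ((\<omega>, s), x) \<partial>jump_measure T U \<omega>) \<partial>M) =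
      (\<integral>\<^sup>+\<omega>. (\<integral>\<^sup>+(s, x). W ((\<omega>, s), x) \<partial>\<nu>\<^sub>0) \<partial>M)"
    and finite_\<nu>\<^sub>0: "emeasure \<nu>\<^sub>0 ({0..H} \<times> UNIV) < \<infinity>"
begin

section \<open>Jump times, stopped sigma-fields and measurability of the points\<close>

lemma stopping: "stopping_time F (T i)"
  using mpp by (auto simp: marked_point_process_def)

lemma T_strict_mono: "\<omega> \<in> space M \<Longrightarrow> i < j \<Longrightarrow> T i \<omega> < T j \<omega>"
  using mpp by (auto simp: marked_point_process_def intro: lift_Suc_mono_less)

lemma T_pos: "\<omega> \<in> space M \<Longrightarrow> 0 < T i \<omega>"
  using mpp T_strict_mono[of \<omega> 0 i] by (cases "i = 0") (auto simp: marked_point_process_def)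

lemma sets_F_subset: "sets (F u) \<subseteq> sets M"
  using sub_F[of "max 0 u"] sets_F_mono[of u "max 0 u"] by auto

lemma subalgebra_F: "subalgebra M (F u)"
  using sets_F_subset by (simp add: subalgebra_def space_F)

lemma measurable_F_M: "f \<in> measurable (F u) N \<Longrightarrow> f \<in> measurable M N"
  using measurable_from_subalg[OF subalgebra_F] .

text \<open>Jump times are real-valued, so a set of the stopped sigma-field is the countable union
  of its parts with \<open>T i\<close> at most \<open>n\<close>, and the n-th part lies in
  \<open>F n\<close>.\<close>

lemma pre_sigma_subset: "sets (pre_sigma (T i)) \<subseteq> sets M"
proof
  fix A assume A: "A \<in> sets (pre_sigma (T i))"
  have "(\<Union>n. {\<omega>\<in>A. T i \<omega> \<le> real n}) \<in> sets M"
    using sets_pre_sigmaD[OF stopping A] sets_F_subset by (intro sets.countable_UN) auto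
  also have "(\<Union>n. {\<omega>\<in>A. T i \<omega> \<le> real n}) = A"
    using real_arch_simple by auto
  finally show "A \<in> sets M" .
qed

lemma point_measurable_pre_sigma:
  "(\<lambda>\<omega>. (T i \<omega>, U i \<omega>)) \<in> pre_sigma (T i) \<rightarrow>\<^sub>M time_marks"
proof -
  have "(\<lambda>\<omega>. (T i \<omega>, U i \<omega>)) \<in> pre_sigma (T i) \<rightarrow>\<^sub>M borel \<Otimes>\<^sub>M borel"
    using mpp measurable_stopping_time_pre_sigma[OF stopping]
    by (intro measurable_Pair) (auto simp: marked_point_process_def)
  then show ?thesis
    unfolding time_marks_def
    by (intro measurable_restrict_space2)
       (auto simp: borel_prod space_pre_sigma dest!: T_pos[of _ i] less_imp_le)
qed

lemma point_measurable[measurable]: "(\<lambda>\<omega>. (T i \<omega>, U i \<omega>)) \<in> M \<rightarrow>\<^sub>M time_marks"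
  using point_measurable_pre_sigma[of i] pre_sigma_subset[of i]
  unfolding measurable_def space_pre_sigma by blast

lemma T_measurable[measurable]: "T i \<in> borel_measurable M"
  using measurable_stopping_time[OF stopping] sets_F_subset space_F by auto

text \<open>By definition of the stopped sigma-field, the part of a preimage on which
  \<open>T i\<close> is at most \<open>u\<close> lies in \<open>F u\<close>; the indicator discards
  the rest. This serves the adaptedness of \<open>point_sum\<close>.\<close>

lemma borel_measurable_F_stopped:
  fixes f :: "'a \<Rightarrow> real"
  assumes f: "f \<in> borel_measurable (pre_sigma (T i))"
  shows "(\<lambda>\<omega>. indicator {..u} (T i \<omega>) * f \<omega>) \<in> borel_measurable (F u)"
proof -
  let ?A = "{\<omega>\<in>space M. T i \<omega> \<le> u}"
  have A: "?A \<in> sets (F u)"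
    using stopping_timeD[OF stopping, of i u] by (simp add: pred_def space_F)
  have "f \<in> borel_measurable (restrict_space (F u) ?A)"
  proof (rule measurableI)
    fix B :: "real set" assume B: "B \<in> sets borel"
    have "{\<omega> \<in> f -` B \<inter> space M. T i \<omega> \<le> u} \<in> sets (F u)"
      using measurable_sets[OF f B] by (intro sets_pre_sigmaD[OF stopping]) (simp add: space_pre_sigma)
    moreover have "f -` B \<inter> space (restrict_space (F u) ?A) = {\<omega> \<in> f -` B \<inter> space M. T i \<omega> \<le> u}"
      by (auto simp: space_restrict_space space_F)
    ultimately show "f -` B \<inter> space (restrict_space (F u) ?A) \<in> sets (restrict_space (F u) ?A)"
      using A by (auto simp: sets_restrict_space_iff space_F)
  qed simp
  then have "(\<lambda>\<omega>. indicator ?A \<omega> *\<^sub>R f \<omega>) \<in> borel_measurable (F u)"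
    using A by (subst borel_measurable_restrict_space_iff[symmetric]) (auto simp: space_F)
  then show ?thesis
    by (rule measurable_cong[THEN iffD1, rotated]) (auto simp: space_F indicator_def)
qed

section \<open>Predictable sets and integrands\<close>

lemma rectangle_predictable:
  assumes "A \<in> sets (F s)" "0 \<le> s" "s < t"
  shows "A \<times> {s<..t} \<in> sets (predictable_sigma M F)"
proof -
  have "A \<times> {s<..t} \<in> {A \<times> {0} |A. A \<in> sets (F 0)} \<union>
      {A \<times> {s<..t} |A s t. 0 \<le> s \<and> s < t \<and> A \<in> sets (F s)}"
    using assms by blast
  then show ?thesis
    unfolding predictable_sigma_def using sets.sets_into_space[of _ "F _"]
    by (subst sets_measure_of) (auto simp: space_F)
qed

lemma space_predictable: "space (predictable_sigma M F) = space M \<times> {0..}"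
  unfolding predictable_sigma_def using sets.sets_into_space[of _ "F _"]
  by (subst space_measure_of) (auto simp: space_F)

lemma ray_predictable:
  assumes "A \<in> sets (F s)" "0 \<le> s"
  shows "A \<times> {s<..} \<in> sets (predictable_sigma M F)"
proof -
  have "(\<Union>n::nat. A \<times> {s<..s + 1 + real n}) \<in> sets (predictable_sigma M F)"
    using assms by (intro sets.countable_UN) (auto intro!: rectangle_predictable)
  also have "(\<Union>n::nat. A \<times> {s<..s + 1 + real n}) = A \<times> {s<..}"
  proof -
    have "\<exists>n. x \<le> s + 1 + real n" for x
      using real_arch_simple[of "x - s - 1"] by (auto simp: algebra_simps)
    then show ?thesis by auto
  qed
  finally show ?thesis .
qed

lemma space_F_sets: "space M \<in> sets (F s)"
  using sets.top[of "F s"] by (simp add: space_F)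

lemma time_predictable[measurable]: "snd \<in> borel_measurable (predictable_sigma M F)"
  unfolding borel_measurable_iff_greater
proof
  fix a :: real
  have "{w \<in> space (predictable_sigma M F). a < snd w} =
      (if a < 0 then space (predictable_sigma M F) else space M \<times> {a<..})"
    by (auto simp: space_predictable)
  then show "{w \<in> space (predictable_sigma M F). a < snd w} \<in> sets (predictable_sigma M F)"
    using ray_predictable[OF space_F_sets, of a] by simp
qed

lemma point_predictable[measurable]:
  "(\<lambda>z. (snd (fst z), snd z)) \<in> predictable_sigma M F \<Otimes>\<^sub>M borel \<rightarrow>\<^sub>M (time_marks :: (real \<times> (real ^ 'd)) measure)"
proof -
  have "(\<lambda>z. (snd (fst z), snd z)) \<in> predictable_sigma M F \<Otimes>\<^sub>M (borel :: (real^'d) measure) \<rightarrow>\<^sub>M borel \<Otimes>\<^sub>M borel"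
    by measurable
  then show ?thesis
    unfolding time_marks_def
    by (intro measurable_restrict_space2) (auto simp: borel_prod space_pair_measure space_predictable)
qed

text \<open>For each outcome the integral against \<open>jump_measure\<close> is a sum over the
  points, which gives the compensation formula its working form.\<close>

lemma compensation_product:
  fixes Q :: "'a \<times> real \<Rightarrow> ennreal" and k :: "real \<times> (real ^ 'd) \<Rightarrow> ennreal"
  assumes [measurable]: "Q \<in> borel_measurable (predictable_sigma M F)" "k \<in> borel_measurable time_marks"
  shows "(\<integral>\<^sup>+\<omega>. (\<Sum>i. Q (\<omega>, T i \<omega>) * k (T i \<omega>, U i \<omega>)) \<partial>M) =
    (\<integral>\<^sup>+\<omega>. (\<integral>\<^sup>+z. Q (\<omega>, fst z) * k z \<partial>\<nu>\<^sub>0) \<partial>M)"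
proof -
  let ?W = "\<lambda>z. Q (fst z) * k (snd (fst z), snd z)"
  have W: "?W \<in> borel_measurable (predictable_sigma M F \<Otimes>\<^sub>M borel)"
    by measurable
  have "(\<integral>\<^sup>+(s, x). ?W ((\<omega>, s), x) \<partial>jump_measure T U \<omega>) =
      (\<Sum>i. Q (\<omega>, T i \<omega>) * k (T i \<omega>, U i \<omega>))" if \<omega>: "\<omega> \<in> space M" for \<omega>
  proof -
    have "(\<lambda>z. (fst z, snd z)) \<in> (time_marks :: (real \<times> (real ^ 'd)) measure) \<rightarrow>\<^sub>M borel \<Otimes>\<^sub>M borel"
      unfolding time_marks_def by (intro measurable_restrict_space1) (simp add: borel_prod)
    then have [measurable]: "fst \<in> (time_marks :: (real \<times> (real ^ 'd)) measure) \<rightarrow>\<^sub>M borel"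
      "snd \<in> (time_marks :: (real \<times> (real ^ 'd)) measure) \<rightarrow>\<^sub>M borel"
      by (auto dest: measurable_fst' measurable_snd')
    \<comment> \<open>The section at a fixed outcome is measurable because every generator is a
      rectangle, whose section is its time set or empty.\<close>
    have "(\<lambda>s. (\<omega>, s)) \<in> restrict_space borel {0..} \<rightarrow>\<^sub>M predictable_sigma M F"
      unfolding predictable_sigma_def
    proof (rule measurable_measure_of)
      fix X assume "X \<in> {A \<times> {0} |A. A \<in> sets (F 0)} \<union>
        {A \<times> {s<..t} |A s t. 0 \<le> s \<and> s < t \<and> A \<in> sets (F s)}"
      then obtain A B where X: "X = A \<times> B" and B: "B \<in> sets borel"
        by auto
      have "Pair \<omega> -` X \<inter> space (restrict_space borel {0..}) = (if \<omega> \<in> A then {0..} \<inter> B else {})"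
        by (auto simp: X space_restrict_space)
      then show "Pair \<omega> -` X \<inter> space (restrict_space borel {0..}) \<in> sets (restrict_space borel {0..})"
        using B by (auto simp: sets_restrict_space)
    qed (use sets.sets_into_space[of _ "F _"] \<omega> in \<open>auto simp: space_F space_restrict_space\<close>)
    moreover have "fst \<in> (time_marks :: (real \<times> (real ^ 'd)) measure) \<rightarrow>\<^sub>M restrict_space borel {0..}"
      by (intro measurable_restrict_space2) (auto simp: space_time_marks)
    ultimately have [measurable]: "(\<lambda>z. (\<omega>, fst z)) \<in> (time_marks :: (real \<times> (real ^ 'd)) measure) \<rightarrow>\<^sub>M predictable_sigma M F"
      using measurable_compose by blast
    have "(\<lambda>i. (T i \<omega>, U i \<omega>)) \<in> count_space UNIV \<rightarrow>\<^sub>M (time_marks :: (real \<times> (real ^ 'd)) measure)"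
      using T_pos[OF \<omega>] by (auto simp: space_time_marks less_imp_le)
    then have "(\<integral>\<^sup>+z. Q (\<omega>, fst z) * k z \<partial>jump_measure T U \<omega>) =
      (\<integral>\<^sup>+i. Q (\<omega>, T i \<omega>) * k (T i \<omega>, U i \<omega>) \<partial>count_space UNIV)"
      unfolding jump_measure_def by (subst nn_integral_distr) auto
    then show ?thesis
      by (simp add: nn_integral_count_space_nat split_beta')
  qed
  then show ?thesis
    using compensation[OF W] by (simp add: split_beta' cong: nn_integral_cong)
qed

text \<open>Predictable rectangles start strictly after the time at which their base is known. On
  times after \<open>u\<close> the projection to the outcome is therefore measurable into
  \<open>F u\<close>, so any \<open>F u\<close>-measurable factor is admissible there.\<close>

lemma window_predictable[measurable]:
  fixes Y :: "'a \<Rightarrow> ennreal"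
  assumes Y: "Y \<in> borel_measurable (F u)" and u: "0 \<le> u"
  shows "(\<lambda>z. Y (fst z) * indicator {u<..v} (snd z)) \<in> borel_measurable (predictable_sigma M F)"
proof -
  let ?P = "predictable_sigma M F"
  have S: "space M \<times> {u<..} \<in> sets ?P"
    using ray_predictable[OF space_F_sets u] .
  have "fst \<in> restrict_space ?P (space M \<times> {u<..}) \<rightarrow>\<^sub>M F u"
  proof (rule measurableI)
    fix A assume A: "A \<in> sets (F u)"
    have "fst -` A \<inter> space (restrict_space ?P (space M \<times> {u<..})) = A \<times> {u<..}"
      using sets.sets_into_space[OF A] u by (auto simp: space_restrict_space space_predictable space_F)
    then show "fst -` A \<inter> space (restrict_space ?P (space M \<times> {u<..})) \<in> sets (restrict_space ?P (space M \<times> {u<..}))"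
      using S ray_predictable[OF A u] sets.sets_into_space[OF A]
      by (auto simp: sets_restrict_space_iff space_F)
  qed (auto simp: space_restrict_space space_F)
  then have "(\<lambda>z. Y (fst z)) \<in> borel_measurable (restrict_space ?P (space M \<times> {u<..}))"
    using Y by (rule measurable_compose)
  then have [measurable]: "(\<lambda>z. Y (fst z) * indicator (space M \<times> {u<..}) z) \<in> borel_measurable ?P"
    using S by (subst (asm) borel_measurable_restrict_space_iff_ennreal) auto
  have "(\<lambda>z. (Y (fst z) * indicator (space M \<times> {u<..}) z) * indicator {..v} (snd z)) \<in> borel_measurable ?P"
    by measurable
  then show ?thesis
    by (rule measurable_cong[THEN iffD1, rotated]) (auto simp: space_predictable indicator_def)
qed

text \<open>Because \<open>\<nu>\<^sub>0\<close> is deterministic, the inner integral is a constant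
  and the expectation factorises. This factorisation against all past information \<open>Y\<close>
  plays the part of independent increments.\<close>

lemma nn_integral_points:
  fixes Y :: "'a \<Rightarrow> ennreal" and h :: "real \<times> (real ^ 'd) \<Rightarrow> ennreal"
  assumes Y: "Y \<in> borel_measurable (F u)" and h[measurable]: "h \<in> borel_measurable time_marks" and u: "0 \<le> u"
  shows "(\<integral>\<^sup>+\<omega>. Y \<omega> * (\<Sum>i. indicator {u<..v} (T i \<omega>) * h (T i \<omega>, U i \<omega>)) \<partial>M) =
    (\<integral>\<^sup>+\<omega>. Y \<omega> \<partial>M) * (\<integral>\<^sup>+z. indicator {u<..v} (fst z) * h z \<partial>\<nu>\<^sub>0)"
proof -
  note [measurable_cong] = sets_\<nu>\<^sub>0
  have [measurable]: "Y \<in> borel_measurable M"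
    using Y by (rule measurable_F_M)
  have "(\<integral>\<^sup>+\<omega>. Y \<omega> * (\<Sum>i. indicator {u<..v} (T i \<omega>) * h (T i \<omega>, U i \<omega>)) \<partial>M) =
    (\<integral>\<^sup>+\<omega>. (\<Sum>i. Y \<omega> * indicator {u<..v} (T i \<omega>) * h (T i \<omega>, U i \<omega>)) \<partial>M)"
    by (simp add: mult.assoc)
  also have "\<dots> = (\<integral>\<^sup>+\<omega>. (\<integral>\<^sup>+z. Y \<omega> * indicator {u<..v} (fst z) * h z \<partial>\<nu>\<^sub>0) \<partial>M)"
    using compensation_product[OF window_predictable[OF Y u, of v] h] by simp
  also have "\<dots> = (\<integral>\<^sup>+\<omega>. Y \<omega> * (\<integral>\<^sup>+z. indicator {u<..v} (fst z) * h z \<partial>\<nu>\<^sub>0) \<partial>M)"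
    by (simp add: mult.assoc nn_integral_cmult)
  finally show ?thesis
    by (simp add: nn_integral_multc)
qed

section \<open>Masses of windows and almost sure finiteness of the points\<close>

definition window_mass :: "real \<Rightarrow> real \<Rightarrow> real" where
  "window_mass u v = measure \<nu>\<^sub>0 ({u<..v} \<times> UNIV)"

lemma window_sets[measurable]: "{u<..v} \<times> UNIV \<in> sets \<nu>\<^sub>0" if "0 \<le> u"
proof -
  have "fst -` {u<..v} \<inter> space (time_marks :: (real \<times> (real ^ 'd)) measure) \<in> sets time_marks"
    by measurable
  also have "fst -` {u<..v} \<inter> space (time_marks :: (real \<times> (real ^ 'd)) measure) = {u<..v} \<times> UNIV"
    using that by (auto simp: space_time_marks)
  finally show ?thesis by (simp add: sets_\<nu>\<^sub>0)
qed

lemma closed_window_sets: "{0..v} \<times> UNIV \<in> sets \<nu>\<^sub>0"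
proof -
  have "fst -` {0..v} \<inter> space (time_marks :: (real \<times> (real ^ 'd)) measure) \<in> sets time_marks"
    by measurable
  also have "fst -` {0..v} \<inter> space (time_marks :: (real \<times> (real ^ 'd)) measure) = {0..v} \<times> UNIV"
    by (auto simp: space_time_marks)
  finally show ?thesis by (simp add: sets_\<nu>\<^sub>0)
qed

text \<open>\<open>measure\<close> returns 0 on sets of infinite mass; up to the horizon the mass is
  finite and the real value is faithful.\<close>

lemma emeasure_window: "0 \<le> u \<Longrightarrow> v \<le> H \<Longrightarrow> emeasure \<nu>\<^sub>0 ({u<..v} \<times> UNIV) = ennreal (window_mass u v)"
  unfolding window_mass_def
proof (rule emeasure_eq_ennreal_measure)
  assume "0 \<le> u" "v \<le> H"
  then have "emeasure \<nu>\<^sub>0 ({u<..v} \<times> UNIV) \<le> emeasure \<nu>\<^sub>0 ({0..H} \<times> UNIV)"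
    by (intro emeasure_mono closed_window_sets) auto
  then show "emeasure \<nu>\<^sub>0 ({u<..v} \<times> UNIV) \<noteq> top"
    using finite_\<nu>\<^sub>0 by (auto simp: top_unique)
qed

lemma nn_integral_window:
  "0 \<le> u \<Longrightarrow> v \<le> H \<Longrightarrow> (\<integral>\<^sup>+z. indicator {u<..v} (fst z) \<partial>\<nu>\<^sub>0) = ennreal (window_mass u v)"
  by (simp add: indicator_window emeasure_window)

text \<open>Points may accumulate, but their expected number in \<open>{0<..H}\<close> is the finite
  mass of that window, so accumulation up to \<open>H\<close> has probability zero. All series over
  points then reduce to finite sums.\<close>

lemma AE_finite_points: "AE \<omega> in M. finite {i. T i \<omega> \<le> H}"
proof -
  have meas: "(\<lambda>\<omega>. \<Sum>i. indicator {0<..H} (T i \<omega>) :: ennreal) \<in> borel_measurable M"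
    by measurable
  have mass: "(\<integral>\<^sup>+\<omega>. (\<Sum>i. indicator {0<..H} (T i \<omega>)) \<partial>M) = ennreal (window_mass 0 H)"
    using nn_integral_points[OF borel_measurable_const borel_measurable_const order_refl, of 1 H 1]
    by (simp only: mult_1 mult_1_right nn_integral_window[OF order_refl order_refl] nn_integral_const emeasure_space_1)
  have "AE \<omega> in M. (\<Sum>i. indicator {0<..H} (T i \<omega>) :: ennreal) \<noteq> \<infinity>"
    by (rule nn_integral_noteq_infinite[OF meas]) (simp only: mass infinity_ennreal_def ennreal_neq_top not_False_eq_True)
  moreover have "AE \<omega> in M. (\<Sum>i. indicator {0<..H} (T i \<omega>) :: ennreal) = emeasure (count_space UNIV) {i. T i \<omega> \<le> H}"
  proof (rule AE_I2)
    fix \<omega> assume "\<omega> \<in> space M"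
    then have "(\<Sum>i. indicator {0<..H} (T i \<omega>) :: ennreal) = (\<Sum>i. indicator {i. T i \<omega> \<le> H} i)"
      using T_pos[of \<omega>] by (intro suminf_cong) (auto simp: indicator_def)
    also have "\<dots> = (\<integral>\<^sup>+i. indicator {i. T i \<omega> \<le> H} i \<partial>count_space UNIV)"
      by (rule nn_integral_count_space_nat[symmetric])
    finally show "(\<Sum>i. indicator {0<..H} (T i \<omega>) :: ennreal) = emeasure (count_space UNIV) {i. T i \<omega> \<le> H}"
      by (simp only: nn_integral_indicator sets_count_space Pow_UNIV UNIV_I)
  qed
  ultimately show ?thesis
  proof eventually_elim
    case (elim \<omega>)
    then have "emeasure (count_space UNIV) {i. T i \<omega> \<le> H} \<noteq> \<infinity>"
      by simp
    then show ?case
      by (metis emeasure_count_space_infinite infinity_ennreal_def subset_UNIV)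
  qed
qed

section \<open>Sums over the points in a window\<close>

text \<open>A series with indicators, not a sum over the random set of points in the window:
  measurability is then immediate, and for \<open>v\<close> up to \<open>H\<close> the two agree
  almost surely.\<close>

definition point_sum :: "real \<Rightarrow> real \<Rightarrow> (real \<times> (real ^ 'd) \<Rightarrow> real) \<Rightarrow> 'a \<Rightarrow> real" where
  "point_sum u v h \<omega> = (\<Sum>i. indicator {u<..v} (T i \<omega>) * h (T i \<omega>, U i \<omega>))"

lemma point_sum_measurable[measurable]:
  assumes [measurable]: "h \<in> borel_measurable time_marks"
  shows "point_sum u v h \<in> borel_measurable M"
  unfolding point_sum_def by measurable

lemma suminf_window:
  fixes f :: "nat \<Rightarrow> 'b::{real_normed_algebra_1}"
  assumes "finite {i. T i \<omega> \<le> H}" "v \<le> H"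
  shows "(\<Sum>i. indicator {u<..v} (T i \<omega>) * f i) = (\<Sum>i | u < T i \<omega> \<and> T i \<omega> \<le> v. f i)"
proof -
  have "finite {i. u < T i \<omega> \<and> T i \<omega> \<le> v}"
    using assms by (rule_tac finite_subset[OF _ assms(1)]) auto
  then show ?thesis
    by (subst suminf_finite[where N="{i. u < T i \<omega> \<and> T i \<omega> \<le> v}"]) (auto simp: indicator_def)
qed

lemma point_sum_eq:
  assumes "finite {i. T i \<omega> \<le> H}" "v \<le> H"
  shows "point_sum u v h \<omega> = (\<Sum>i | u < T i \<omega> \<and> T i \<omega> \<le> v. h (T i \<omega>, U i \<omega>))"
  unfolding point_sum_def using assms by (rule suminf_window)

lemma integrable_window:
  fixes h :: "real \<times> (real ^ 'd) \<Rightarrow> 'b::{banach,second_countable_topology}"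
  assumes [measurable]: "h \<in> borel_measurable time_marks" and h: "\<And>z. norm (h z) \<le> B" and uv: "0 \<le> u" "v \<le> H"
  shows "set_integrable \<nu>\<^sub>0 ({u<..v} \<times> UNIV) h"
proof -
  note [measurable_cong] = sets_\<nu>\<^sub>0
  have "set_integrable \<nu>\<^sub>0 ({u<..v} \<times> UNIV) (\<lambda>_. B)"
    unfolding set_integrable_def using uv by (simp add: emeasure_window window_sets)
  then show ?thesis
    unfolding set_integrable_def
    using window_sets[OF uv(1), of v] h
    by (elim Bochner_Integration.integrable_bound)
      (auto simp: indicator_def intro!: AE_I2 order_trans[OF h])
qed

text \<open>This is \<open>nn_integral_points\<close> moved to real integrals. Bounded
  \<open>Y\<close> and \<open>h\<close> together with the finite mass make both factors finite, and
  almost sure finiteness of the points makes the extended and the real sums agree.\<close>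

lemma has_integral_points_nonneg:
  fixes Y :: "'a \<Rightarrow> real" and h :: "real \<times> (real ^ 'd) \<Rightarrow> real"
  assumes Y: "Y \<in> borel_measurable (F u)" and h[measurable]: "h \<in> borel_measurable time_marks"
    and uv: "0 \<le> u" "v \<le> H"
    and Yb: "\<And>\<omega>. 0 \<le> Y \<omega>" "\<And>\<omega>. Y \<omega> \<le> B" and hb: "\<And>z. 0 \<le> h z" "\<And>z. h z \<le> B"
  shows "has_bochner_integral M (\<lambda>\<omega>. Y \<omega> * point_sum u v h \<omega>)
    ((LINT \<omega>|M. Y \<omega>) * (LINT z:{u<..v} \<times> UNIV|\<nu>\<^sub>0. h z))"
proof (rule has_bochner_integral_nn_integral)
  note [measurable_cong] = sets_\<nu>\<^sub>0
  have YM[measurable]: "Y \<in> borel_measurable M"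
    using Y by (rule measurable_F_M)
  show "(\<lambda>\<omega>. Y \<omega> * point_sum u v h \<omega>) \<in> borel_measurable M"
    by measurable
  show "0 \<le> (LINT \<omega>|M. Y \<omega>) * (LINT z:{u<..v} \<times> UNIV|\<nu>\<^sub>0. h z)"
    unfolding set_lebesgue_integral_def using Yb hb by (intro mult_nonneg_nonneg integral_nonneg) auto
  show "AE \<omega> in M. 0 \<le> Y \<omega> * point_sum u v h \<omega>"
    using AE_finite_points
    by eventually_elim (use uv Yb hb in \<open>auto simp: point_sum_eq intro!: mult_nonneg_nonneg sum_nonneg\<close>)
  have "(\<integral>\<^sup>+\<omega>. ennreal (Y \<omega> * point_sum u v h \<omega>) \<partial>M) =
    (\<integral>\<^sup>+\<omega>. ennreal (Y \<omega>) * (\<Sum>i. indicator {u<..v} (T i \<omega>) * ennreal (h (T i \<omega>, U i \<omega>))) \<partial>M)"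
  proof (rule nn_integral_cong_AE)
    show "AE \<omega> in M. ennreal (Y \<omega> * point_sum u v h \<omega>) =
      ennreal (Y \<omega>) * (\<Sum>i. indicator {u<..v} (T i \<omega>) * ennreal (h (T i \<omega>, U i \<omega>)))"
      using AE_finite_points
    proof eventually_elim
      case (elim \<omega>)
      have fin: "finite {i. u < T i \<omega> \<and> T i \<omega> \<le> v}"
        using uv by (intro finite_subset[OF _ elim]) auto
      have "(\<Sum>i. indicator {u<..v} (T i \<omega>) * ennreal (h (T i \<omega>, U i \<omega>))) =
        (\<Sum>i | u < T i \<omega> \<and> T i \<omega> \<le> v. ennreal (h (T i \<omega>, U i \<omega>)))"
        using fin by (subst suminf_finite[where N="{i. u < T i \<omega> \<and> T i \<omega> \<le> v}"]) (auto simp: indicator_def)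
      then show ?case
        using elim uv Yb hb by (simp add: point_sum_eq ennreal_mult' sum_nonneg)
    qed
  qed
  also have "\<dots> = (\<integral>\<^sup>+\<omega>. ennreal (Y \<omega>) \<partial>M) * (\<integral>\<^sup>+z. indicator {u<..v} (fst z) * ennreal (h z) \<partial>\<nu>\<^sub>0)"
    using Y uv by (intro nn_integral_points) auto
  also have "(\<integral>\<^sup>+\<omega>. ennreal (Y \<omega>) \<partial>M) = ennreal (LINT \<omega>|M. Y \<omega>)"
    using Yb by (intro nn_integral_eq_integral integrable_const_bound[where B=B]) auto
  also have "(\<integral>\<^sup>+z. indicator {u<..v} (fst z) * ennreal (h z) \<partial>\<nu>\<^sub>0) = 
      (\<integral>\<^sup>+z. ennreal (indicator ({u<..v} \<times> UNIV) z * h z) \<partial>\<nu>\<^sub>0)"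
    by (intro nn_integral_cong) (auto simp: indicator_def)
  also have "\<dots> = ennreal (LINT z:{u<..v} \<times> UNIV|\<nu>\<^sub>0. h z)"
    unfolding set_lebesgue_integral_def real_scaleR_def using hb uv
    by (intro nn_integral_eq_integral)
      (auto intro!: integrable_window[of h B, unfolded set_integrable_def real_scaleR_def])
  also have "ennreal (LINT \<omega>|M. Y \<omega>) * \<dots> = ennreal ((LINT \<omega>|M. Y \<omega>) * (LINT z:{u<..v} \<times> UNIV|\<nu>\<^sub>0. h z))"
    using Yb by (intro ennreal_mult'[symmetric] integral_nonneg) auto
  finally show "(\<integral>\<^sup>+\<omega>. ennreal (Y \<omega> * point_sum u v h \<omega>) \<partial>M) =
    ennreal ((LINT \<omega>|M. Y \<omega>) * (LINT z:{u<..v} \<times> UNIV|\<nu>\<^sub>0. h z))" .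
qed

text \<open>Adding \<open>B\<close> to both \<open>Y\<close> and \<open>h\<close> reduces the signed case to the nonnegative one.\<close>

lemma has_integral_points_real:
  fixes Y :: "'a \<Rightarrow> real" and h :: "real \<times> (real ^ 'd) \<Rightarrow> real"
  assumes Y: "Y \<in> borel_measurable (F u)" and h[measurable]: "h \<in> borel_measurable time_marks"
    and uv: "0 \<le> u" "v \<le> H" and Yb: "\<And>\<omega>. \<bar>Y \<omega>\<bar> \<le> B" and hb: "\<And>z. \<bar>h z\<bar> \<le> B"
  shows "has_bochner_integral M (\<lambda>\<omega>. Y \<omega> * point_sum u v h \<omega>)
    ((LINT \<omega>|M. Y \<omega>) * (LINT z:{u<..v} \<times> UNIV|\<nu>\<^sub>0. h z))"
proof -
  have B: "0 \<le> B"
    using Yb[of undefined] by linarith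
  have YM[measurable]: "Y \<in> borel_measurable M"
    using Y by (rule measurable_F_M)
  have Yb': "0 \<le> Y \<omega> + B" "Y \<omega> + B \<le> 2 * B" for \<omega>
    using Yb[of \<omega>] by (auto simp: abs_le_iff)
  have hb': "0 \<le> h z + B" "h z + B \<le> 2 * B" for z
    using hb[of z] by (auto simp: abs_le_iff)
  let ?b = "\<lambda>_. B" and ?Y = "\<lambda>\<omega>. Y \<omega> + B" and ?h = "\<lambda>z. h z + B"
  let ?E = "LINT \<omega>|M. Y \<omega>" and ?I = "LINT z:{u<..v} \<times> UNIV|\<nu>\<^sub>0. h z"
  let ?c = "LINT z:{u<..v} \<times> UNIV|\<nu>\<^sub>0. B"
  have "integrable M Y"
    using Yb by (intro integrable_const_bound[where B=B]) auto
  then have EY: "(LINT \<omega>|M. ?Y \<omega>) = ?E + B"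
    by (simp add: prob_space)
  have Ih: "(LINT z:{u<..v} \<times> UNIV|\<nu>\<^sub>0. ?h z) = ?I + ?c"
    using uv hb B by (intro set_integral_add integrable_window[where B=B]) auto
  have bb: "0 \<le> B" "B \<le> 2 * B"
    using B by auto
  have Y': "?Y \<in> borel_measurable (F u)" and h': "?h \<in> borel_measurable time_marks"
    and bY: "?b \<in> borel_measurable (F u)" and bh: "?b \<in> borel_measurable time_marks"
    by (auto intro!: borel_measurable_add Y h)
  have Eb: "(LINT \<omega>|M. B) = B"
    by (simp add: prob_space)
  have 1: "has_bochner_integral M (\<lambda>\<omega>. ?Y \<omega> * point_sum u v ?h \<omega>) ((?E + B) * (?I + ?c))"
    using has_integral_points_nonneg[OF Y' h' uv Yb' hb'] unfolding EY Ih .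
  have 2: "has_bochner_integral M (\<lambda>\<omega>. ?Y \<omega> * point_sum u v ?b \<omega>) ((?E + B) * ?c)"
    using has_integral_points_nonneg[OF Y' bh uv Yb' bb] unfolding EY .
  have 3: "has_bochner_integral M (\<lambda>\<omega>. B * point_sum u v ?h \<omega>) (B * (?I + ?c))"
    using has_integral_points_nonneg[OF bY h' uv bb hb'] unfolding Eb Ih .
  have 4: "has_bochner_integral M (\<lambda>\<omega>. B * point_sum u v ?b \<omega>) (B * ?c)"
    using has_integral_points_nonneg[OF bY bh uv bb bb] unfolding Eb .
  \<comment> \<open>The identity behind this is yh = (y+b)(h+b) - (y+b)b - (b(h+b) - bb), with four
    products of non-negative factors.\<close>
  let ?R = "\<lambda>\<omega>. ?Y \<omega> * point_sum u v ?h \<omega> - ?Y \<omega> * point_sum u v ?b \<omega> - (B * point_sum u v ?h \<omega> - B * point_sum u v ?b \<omega>)"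
  have R: "has_bochner_integral M ?R
     ((?E + B) * (?I + ?c) - (?E + B) * ?c - (B * (?I + ?c) - B * ?c))"
    by (intro has_bochner_integral_diff 1 2 3 4)
  have "AE \<omega> in M. ?R \<omega> = Y \<omega> * point_sum u v h \<omega>"
    using AE_finite_points
  proof eventually_elim
    case (elim \<omega>)
    then have "point_sum u v ?h \<omega> = point_sum u v h \<omega> + point_sum u v ?b \<omega>"
      using uv by (simp add: point_sum_eq sum.distrib)
    then show ?case
      by (simp add: algebra_simps)
  qed
  then have "has_bochner_integral M (\<lambda>\<omega>. Y \<omega> * point_sum u v h \<omega>)
     ((?E + B) * (?I + ?c) - (?E + B) * ?c - (B * (?I + ?c) - B * ?c))"
    using R by (subst (asm) has_bochner_integral_cong_AE) auto
  then show ?thesis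
    by (simp add: algebra_simps)
qed

text \<open>Assembled from two real sums so that the real compensation formula applies to each
  component.\<close>

definition cpoint_sum :: "real \<Rightarrow> real \<Rightarrow> (real \<times> (real ^ 'd) \<Rightarrow> complex) \<Rightarrow> 'a \<Rightarrow> complex" where
  "cpoint_sum u v f \<omega> = Complex (point_sum u v (\<lambda>z. Re (f z)) \<omega>) (point_sum u v (\<lambda>z. Im (f z)) \<omega>)"

lemma cpoint_sum_eq:
  assumes "finite {i. T i \<omega> \<le> H}" "v \<le> H"
  shows "cpoint_sum u v f \<omega> = (\<Sum>i | u < T i \<omega> \<and> T i \<omega> \<le> v. f (T i \<omega>, U i \<omega>))"
  using assms by (intro complex_eqI) (simp_all add: cpoint_sum_def point_sum_eq)

text \<open>The complex product expands into four real ones. With \<open>Y\<close> ranging over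
  bounded \<open>F u\<close>-measurable functions, this identifies the conditional mean of the sum
  given \<open>F u\<close>.\<close>

lemma has_integral_points_complex:
  fixes Y :: "'a \<Rightarrow> complex" and f :: "real \<times> (real ^ 'd) \<Rightarrow> complex"
  assumes Y: "Y \<in> borel_measurable (F u)" and f[measurable]: "f \<in> borel_measurable time_marks"
    and uv: "0 \<le> u" "v \<le> H" and Yb: "\<And>\<omega>. norm (Y \<omega>) \<le> B" and fb: "\<And>z. norm (f z) \<le> B"
  shows "has_bochner_integral M (\<lambda>\<omega>. Y \<omega> * cpoint_sum u v f \<omega>)
    ((LINT \<omega>|M. Y \<omega>) * (LINT z:{u<..v} \<times> UNIV|\<nu>\<^sub>0. f z))"
proof -
  note [measurable_cong] = sets_\<nu>\<^sub>0
  have YM[measurable]: "Y \<in> borel_measurable M"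
    using Y by (rule measurable_F_M)
  have [measurable]: "(\<lambda>\<omega>. Re (Y \<omega>)) \<in> borel_measurable (F u)" "(\<lambda>\<omega>. Im (Y \<omega>)) \<in> borel_measurable (F u)"
    using Y by measurable
  have b: "\<bar>Re (Y \<omega>)\<bar> \<le> B" "\<bar>Im (Y \<omega>)\<bar> \<le> B" "\<bar>Re (f z)\<bar> \<le> B" "\<bar>Im (f z)\<bar> \<le> B" for \<omega> z
    using Yb fb abs_Re_le_cmod abs_Im_le_cmod order_trans by blast+
  let ?E1 = "LINT \<omega>|M. Re (Y \<omega>)" and ?E2 = "LINT \<omega>|M. Im (Y \<omega>)"
  let ?I1 = "LINT z:{u<..v} \<times> UNIV|\<nu>\<^sub>0. Re (f z)" and ?I2 = "LINT z:{u<..v} \<times> UNIV|\<nu>\<^sub>0. Im (f z)"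
  let ?X1 = "point_sum u v (\<lambda>z. Re (f z))" and ?X2 = "point_sum u v (\<lambda>z. Im (f z))"
  have "integrable M Y"
    using Yb by (intro integrable_const_bound[where B=B]) auto
  then have E: "(LINT \<omega>|M. Y \<omega>) = Complex ?E1 ?E2"
    by (intro complex_eqI) simp_all
  have "integrable \<nu>\<^sub>0 (\<lambda>z. indicator ({u<..v} \<times> UNIV) z *\<^sub>R f z)"
    using integrable_window[OF f fb uv] by (simp add: set_integrable_def)
  from integral_Re[OF this] integral_Im[OF this]
  have I: "(LINT z:{u<..v} \<times> UNIV|\<nu>\<^sub>0. f z) = Complex ?I1 ?I2"
    unfolding set_lebesgue_integral_def by (intro complex_eqI) simp_all
  have c: "has_bochner_integral M (\<lambda>\<omega>. Re (Y \<omega>) * ?X1 \<omega> - Im (Y \<omega>) * ?X2 \<omega>) (?E1 * ?I1 - ?E2 * ?I2)"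
    "has_bochner_integral M (\<lambda>\<omega>. Re (Y \<omega>) * ?X2 \<omega> + Im (Y \<omega>) * ?X1 \<omega>) (?E1 * ?I2 + ?E2 * ?I1)"
    using uv b by (intro has_bochner_integral_diff has_bochner_integral_add has_integral_points_real[where B=B]; measurable)+
  have "has_bochner_integral M (\<lambda>\<omega>. complex_of_real (Re (Y \<omega>) * ?X1 \<omega> - Im (Y \<omega>) * ?X2 \<omega>) +
      \<i> * complex_of_real (Re (Y \<omega>) * ?X2 \<omega> + Im (Y \<omega>) * ?X1 \<omega>))
      (complex_of_real (?E1 * ?I1 - ?E2 * ?I2) + \<i> * complex_of_real (?E1 * ?I2 + ?E2 * ?I1))"
    by (intro has_bochner_integral_add[OF has_bochner_integral_of_real[OF c(1)]]
        has_bochner_integral_mult_right has_bochner_integral_of_real[OF c(2)])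
  moreover have "complex_of_real (Re (Y \<omega>) * ?X1 \<omega> - Im (Y \<omega>) * ?X2 \<omega>) +
      \<i> * complex_of_real (Re (Y \<omega>) * ?X2 \<omega> + Im (Y \<omega>) * ?X1 \<omega>) = Y \<omega> * cpoint_sum u v f \<omega>" for \<omega>
    by (simp add: complex_eq_iff cpoint_sum_def)
  moreover have "complex_of_real (?E1 * ?I1 - ?E2 * ?I2) + \<i> * complex_of_real (?E1 * ?I2 + ?E2 * ?I1) =
      Complex ?E1 ?E2 * Complex ?I1 ?I2"
    by (simp add: complex_eq_iff)
  ultimately show ?thesis
    unfolding E I by simp
qed

text \<open>The number of unordered pairs of points in the window, and 0 if the window holds
  infinitely many points. Summing over the later member \<open>j\<close> matches
  \<open>norm_prod_one_plus_le\<close> and lets the compensation formula act on \<open>j\<close>,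
  with the earlier points as predictable integrand.\<close>

definition pair_count :: "real \<Rightarrow> real \<Rightarrow> 'a \<Rightarrow> nat" where
  "pair_count u v \<omega> = (\<Sum>j | u < T j \<omega> \<and> T j \<omega> \<le> v. card {i \<in> {i. u < T i \<omega> \<and> T i \<omega> \<le> v}. i < j})"

text \<open>The strict inequality between \<open>T i\<close> and the current time is essential: a
  rational \<open>q\<close> fits in between, the event is known at time \<open>q\<close>, and the
  ray after \<open>q\<close> above it is predictable.\<close>

lemma earlier_points_predictable:
  assumes u: "0 \<le> u"
  shows "(\<lambda>w. indicator {u<..<snd w} (T i (fst w)) :: ennreal) \<in> borel_measurable (predictable_sigma M F)"
proof -
  have "(\<Union>q\<in>{q\<in>\<rat>. u \<le> q}. {\<omega>\<in>space M. u < T i \<omega> \<and> T i \<omega> \<le> q} \<times> {q<..}) \<in> sets (predictable_sigma M F)"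
  proof (intro sets.countable_UN'' ray_predictable)
    show "countable {q \<in> \<rat>. u \<le> q}"
      by (intro countable_Collect countable_rat)
    fix q assume q: "q \<in> {q \<in> \<rat>. u \<le> q}"
    then show "0 \<le> q" using u by simp
    have "Measurable.pred (F q) (\<lambda>\<omega>. \<not> T i \<omega> \<le> u \<and> T i \<omega> \<le> q)"
      using stopping_time_le_const[OF stopping] q by (intro pred_intros_logic) auto
    then show "{\<omega>\<in>space M. u < T i \<omega> \<and> T i \<omega> \<le> q} \<in> sets (F q)"
      by (simp add: pred_def space_F not_le)
  qed
  also have "(\<Union>q\<in>{q\<in>\<rat>. u \<le> q}. {\<omega>\<in>space M. u < T i \<omega> \<and> T i \<omega> \<le> q} \<times> {q<..}) =
      {w \<in> space (predictable_sigma M F). T i (fst w) \<in> {u<..<snd w}}"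
  proof (intro set_eqI iffI)
    fix w assume "w \<in> {w \<in> space (predictable_sigma M F). T i (fst w) \<in> {u<..<snd w}}"
    then have w: "fst w \<in> space M" "u < T i (fst w)" "T i (fst w) < snd w"
      by (auto simp: space_predictable)
    from Rats_dense_in_real[OF w(3)] obtain q where "q \<in> \<rat>" "T i (fst w) < q" "q < snd w"
      by auto
    with w show "w \<in> (\<Union>q\<in>{q\<in>\<rat>. u \<le> q}. {\<omega>\<in>space M. u < T i \<omega> \<and> T i \<omega> \<le> q} \<times> {q<..})"
      by (intro UN_I[of q]) (auto simp: mem_Times_iff)
  qed (use u in \<open>auto simp: space_predictable\<close>)
  finally have *: "{w \<in> space (predictable_sigma M F). T i (fst w) \<in> {u<..<snd w}} \<in> sets (predictable_sigma M F)" .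
  have "(\<lambda>w. indicator {w \<in> space (predictable_sigma M F). T i (fst w) \<in> {u<..<snd w}} w :: ennreal)
      \<in> borel_measurable (predictable_sigma M F)"
    using * by (rule borel_measurable_indicator)
  then show ?thesis
    by (rule measurable_cong[THEN iffD1, rotated]) (auto simp: indicator_def)
qed

text \<open>The factor \<open>c\<close> cannot be pulled out afterwards without proving \<^const>\<open>pair_count\<close> measurable.\<close>

lemma nn_integral_pair_count_le:
  assumes uv: "0 \<le> u" "v \<le> H"
  shows "(\<integral>\<^sup>+\<omega>. ennreal (real (pair_count u v \<omega>)) * c \<partial>M) \<le> ennreal ((window_mass u v)\<^sup>2) * c"
proof -
  note [measurable_cong] = sets_\<nu>\<^sub>0
  let ?N = "\<lambda>\<omega>. \<Sum>i. indicator {u<..v} (T i \<omega>) :: ennreal"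
  let ?q = "\<lambda>w. \<Sum>i. indicator {u<..<snd w} (T i (fst w)) :: ennreal"
  let ?Q = "\<lambda>w. indicator {u<..v} (snd w) * ?q w"
  have Q: "?Q \<in> borel_measurable (predictable_sigma M F)"
    using earlier_points_predictable[OF uv(1)] by measurable
  have "(\<integral>\<^sup>+\<omega>. ennreal (real (pair_count u v \<omega>)) * c \<partial>M) = (\<integral>\<^sup>+\<omega>. (\<Sum>j. ?Q (\<omega>, T j \<omega>) * c) \<partial>M)"
  proof (rule nn_integral_cong_AE, use AE_finite_points AE_space in eventually_elim)
    fix \<omega> assume fin: "finite {i. T i \<omega> \<le> H}" and \<omega>: "\<omega> \<in> space M"
    let ?J = "{i. u < T i \<omega> \<and> T i \<omega> \<le> v}"
    have J: "finite ?J"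
      using uv by (intro finite_subset[OF _ fin]) auto
    \<comment> \<open>Jump times increase strictly, so the points strictly before \<open>T j\<close>
      are exactly those of smaller index.\<close>
    have less: "T i \<omega> < T j \<omega> \<longleftrightarrow> i < j" for i j
      using T_strict_mono[OF \<omega>] by (metis less_asym linorder_neqE_nat)
    have "(\<Sum>j. ?Q (\<omega>, T j \<omega>)) = (\<Sum>j\<in>?J. ?Q (\<omega>, T j \<omega>))"
      using J by (intro suminf_finite) (auto simp: indicator_def)
    also have "\<dots> = (\<Sum>j\<in>?J. of_nat (card {i\<in>?J. i < j}))"
    proof (rule sum.cong)
      fix j assume j: "j \<in> ?J"
      have "(\<Sum>i. indicator {u<..<T j \<omega>} (T i \<omega>) :: ennreal) =
          (\<Sum>i\<in>{i\<in>?J. i < j}. indicator {u<..<T j \<omega>} (T i \<omega>))"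
      proof (rule suminf_finite)
        show "finite {i\<in>?J. i < j}"
          using J by simp
        fix i assume "i \<notin> {i\<in>?J. i < j}"
        then have "T i \<omega> \<notin> {u<..<T j \<omega>}"
          using j less[of i j] by force
        then show "indicator {u<..<T j \<omega>} (T i \<omega>) = (0 :: ennreal)"
          by simp
      qed
      also have "\<dots> = (\<Sum>i\<in>{i\<in>?J. i < j}. 1)"
        by (intro sum.cong) (auto simp: less)
      finally show "?Q (\<omega>, T j \<omega>) = of_nat (card {i\<in>?J. i < j})"
        using j by simp
    qed simp
    finally have "(\<Sum>j. ?Q (\<omega>, T j \<omega>)) = ennreal (real (pair_count u v \<omega>))"
      by (simp add: pair_count_def ennreal_of_nat_eq_real_of_nat sum_ennreal)
    then show "ennreal (real (pair_count u v \<omega>)) * c = (\<Sum>j. ?Q (\<omega>, T j \<omega>) * c)"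
      by (simp only: ennreal_suminf_multc)
  qed
  also have "\<dots> = (\<integral>\<^sup>+\<omega>. (\<integral>\<^sup>+z. ?Q (\<omega>, fst z) * c \<partial>\<nu>\<^sub>0) \<partial>M)"
    using Q by (rule compensation_product) simp
  \<comment> \<open>The earlier points are at most all points of the window. Their number is
    constant in \<open>z\<close>, so the integral over \<open>\<nu>\<^sub>0\<close> yields one
    factor \<open>window_mass u v\<close> and its expectation yields the other.\<close>
  also have "\<dots> \<le> (\<integral>\<^sup>+\<omega>. (\<integral>\<^sup>+z. (?N \<omega> * c) * indicator {u<..v} (fst z) \<partial>\<nu>\<^sub>0) \<partial>M)"
  proof (intro nn_integral_mono)
    fix \<omega> z
    show "?Q (\<omega>, fst z) * c \<le> (?N \<omega> * c) * indicator {u<..v} (fst z)"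
    proof (cases "fst z \<in> {u<..v}")
      case True
      have "?q (\<omega>, fst z) \<le> ?N \<omega>"
        using True by (intro suminf_le) (auto simp: indicator_def)
      then show ?thesis using True by (simp add: mult_right_mono)
    qed simp
  qed
  also have "\<dots> = (\<integral>\<^sup>+\<omega>. ?N \<omega> * (c * ennreal (window_mass u v)) \<partial>M)"
    using nn_integral_window[OF uv] by (subst nn_integral_cmult) (auto simp: mult.assoc)
  also have "\<dots> = (\<integral>\<^sup>+\<omega>. ?N \<omega> \<partial>M) * (c * ennreal (window_mass u v))"
    by (intro nn_integral_multc) measurable
  also have "(\<integral>\<^sup>+\<omega>. ?N \<omega> \<partial>M) = ennreal (window_mass u v)"
    using nn_integral_points[OF borel_measurable_const borel_measurable_const uv(1), of 1 v 1]
    by (simp only: mult_1 mult_1_right nn_integral_window[OF uv] nn_integral_const emeasure_space_1)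
  finally show ?thesis
    by (simp add: power2_eq_square ennreal_mult' window_mass_def ac_simps)
qed

section \<open>Characteristic function of the increments\<close>

text \<open>The exponent of a compound Poisson characteristic function, written \<Lambda> in the
  overview, with \<theta> absorbed in \<open>g\<close>.\<close>

definition char_exponent :: "(real \<times> (real ^ 'd) \<Rightarrow> real) \<Rightarrow> real \<Rightarrow> real \<Rightarrow> complex" where
  "char_exponent g u v = (LINT z:{u<..v} \<times> UNIV|\<nu>\<^sub>0. exp (\<i> * complex_of_real (g z)) - 1)"

lemma integrable_iexp_minus_one:
  assumes [measurable]: "g \<in> borel_measurable time_marks" and uv: "0 \<le> u" "v \<le> H"
  shows "set_integrable \<nu>\<^sub>0 ({u<..v} \<times> UNIV) (\<lambda>z. exp (\<i> * complex_of_real (g z)) - 1)"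
  using uv by (intro integrable_window[where B=2] norm_iexp_minus_one_le) measurable

lemma norm_char_exponent_le:
  assumes g: "g \<in> borel_measurable time_marks" and uv: "0 \<le> u" "v \<le> H"
  shows "norm (char_exponent g u v) \<le> 2 * window_mass u v"
proof -
  note [measurable_cong] = sets_\<nu>\<^sub>0
  have "norm (char_exponent g u v) \<le>
      (LINT z|\<nu>\<^sub>0. norm (indicator ({u<..v} \<times> UNIV) z *\<^sub>R (exp (\<i> * complex_of_real (g z)) - 1)))"
    unfolding char_exponent_def set_lebesgue_integral_def by (rule integral_norm_bound)
  also have "\<dots> \<le> (LINT z|\<nu>\<^sub>0. 2 * indicator ({u<..v} \<times> UNIV) z)"
  proof (rule integral_mono)
    show "integrable \<nu>\<^sub>0 (\<lambda>z. norm (indicator ({u<..v} \<times> UNIV) z *\<^sub>R (exp (\<i> * complex_of_real (g z)) - 1)))"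
      using integrable_iexp_minus_one[OF g uv] unfolding set_integrable_def by (rule integrable_norm)
    show "integrable \<nu>\<^sub>0 (\<lambda>z. 2 * indicator ({u<..v} \<times> UNIV) z :: real)"
      using uv by (simp add: window_sets emeasure_window)
  qed (auto simp: indicator_def norm_iexp_minus_one_le)
  also have "\<dots> = 2 * window_mass u v"
    using window_sets[OF uv(1), of v] by (simp add: window_mass_def)
  finally show ?thesis .
qed

lemma char_exponent_add:
  assumes "g \<in> borel_measurable time_marks" "0 \<le> u" "u \<le> v" "v \<le> w" "w \<le> H"
  shows "char_exponent g u w = char_exponent g u v + char_exponent g v w"
proof -
  have "{u<..w} \<times> (UNIV :: (real ^ 'd) set) = {u<..v} \<times> UNIV \<union> {v<..w} \<times> UNIV"
    using assms by auto
  then show ?thesis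
    unfolding char_exponent_def using assms
    by (auto intro!: set_integral_Un integrable_iexp_minus_one)
qed

lemma window_mass_mono:
  assumes "0 \<le> u" "u \<le> u'" "v' \<le> v" "v \<le> H"
  shows "window_mass u' v' \<le> window_mass u v"
  unfolding window_mass_def using assms emeasure_window[of u v]
  by (intro measure_mono_fmeasurable) (auto simp: fmeasurable_def window_sets)

lemma point_sum_add:
  assumes "finite {i. T i \<omega> \<le> H}" "u \<le> v" "v \<le> w" "w \<le> H"
  shows "point_sum u w h \<omega> = point_sum u v h \<omega> + point_sum v w h \<omega>"
proof -
  have fin: "finite {i. a < T i \<omega> \<and> T i \<omega> \<le> b}" if "b \<le> H" for a b
    using that by (intro finite_subset[OF _ assms(1)]) auto
  have "{i. u < T i \<omega> \<and> T i \<omega> \<le> w} = {i. u < T i \<omega> \<and> T i \<omega> \<le> v} \<union> {i. v < T i \<omega> \<and> T i \<omega> \<le> w}"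
    using assms by auto
  then show ?thesis
    using assms fin by (simp add: point_sum_eq) (subst sum.union_disjoint, auto)
qed

text \<open>Here it matters that the mark \<open>U i\<close> is known at time \<open>T i\<close>:
  each summand vanishes unless \<open>T i\<close> is at most \<open>u\<close>, and is
  \<open>F u\<close>-measurable.\<close>

lemma point_sum_adapted:
  assumes h: "h \<in> borel_measurable time_marks"
  shows "point_sum 0 u h \<in> borel_measurable (F u)"
proof -
  have "(\<lambda>\<omega>. h (T i \<omega>, U i \<omega>)) \<in> borel_measurable (pre_sigma (T i))" for i
    using point_measurable_pre_sigma h by (rule measurable_compose)
  then have "(\<lambda>\<omega>. indicator {..u} (T i \<omega>) * h (T i \<omega>, U i \<omega>)) \<in> borel_measurable (F u)" for i
    by (rule borel_measurable_F_stopped)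
  then have "(\<lambda>\<omega>. \<Sum>i. indicator {..u} (T i \<omega>) * h (T i \<omega>, U i \<omega>)) \<in> borel_measurable (F u)"
    by measurable
  then show ?thesis
    unfolding point_sum_def
    by (rule measurable_cong[THEN iffD1, rotated])
      (auto simp: space_F indicator_def T_pos intro!: suminf_cong)
qed

lemma exp_point_sum_approx:
  assumes "finite {i. T i \<omega> \<le> H}" "v \<le> H"
  shows "norm (exp (\<i> * complex_of_real (point_sum u v g \<omega>)) - 1 -
    cpoint_sum u v (\<lambda>z. exp (\<i> * complex_of_real (g z)) - 1) \<omega>) \<le> 4 * real (pair_count u v \<omega>)"
proof -
  let ?J = "{i. u < T i \<omega> \<and> T i \<omega> \<le> v}"
  let ?f = "\<lambda>i. exp (\<i> * complex_of_real (g (T i \<omega>, U i \<omega>))) - 1"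
  have "finite ?J"
    using assms by (intro finite_subset[OF _ assms(1)]) auto
  moreover have "exp (\<i> * complex_of_real (point_sum u v g \<omega>)) = (\<Prod>i\<in>?J. 1 + ?f i)"
    using assms \<open>finite ?J\<close> by (simp add: point_sum_eq sum_distrib_left exp_sum)
  ultimately show ?thesis
    using norm_prod_one_plus_le[of ?J ?f] assms by (simp add: cpoint_sum_eq pair_count_def)
qed

text \<open>Two errors add up. Linearising the product over the points costs four times the expected
  number of pairs, which gives the 4. Replacing one plus the exponent by its exponential costs a
  Taylor remainder; the exponent is at most twice the mass of the window, which gives
  \<open>4 * exp (2 * window_mass 0 H)\<close>.\<close>

lemma char_increment:
  fixes Z :: "'a \<Rightarrow> complex"
  assumes Z: "Z \<in> borel_measurable (F u)" and Zb: "\<And>\<omega>. norm (Z \<omega>) \<le> 1"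
    and g[measurable]: "g \<in> borel_measurable time_marks" and uv: "0 \<le> u" "u \<le> v" "v \<le> H"
  shows "norm ((LINT \<omega>|M. Z \<omega> * exp (\<i> * complex_of_real (point_sum u v g \<omega>))) -
      (LINT \<omega>|M. Z \<omega>) * exp (char_exponent g u v))
    \<le> (4 + 4 * exp (2 * window_mass 0 H)) * (window_mass u v)\<^sup>2"
proof -
  have ZM[measurable]: "Z \<in> borel_measurable M"
    using Z by (rule measurable_F_M)
  let ?f = "\<lambda>z. exp (\<i> * complex_of_real (g z)) - 1"
  let ?D = "\<lambda>\<omega>. exp (\<i> * complex_of_real (point_sum u v g \<omega>))"
  let ?L = "char_exponent g u v" and ?w = "window_mass u v"
  have Zi: "integrable M Z"
    using Zb by (intro integrable_const_bound[where B=1]) auto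
  have ZD: "integrable M (\<lambda>\<omega>. Z \<omega> * ?D \<omega>)"
    using Zb by (intro integrable_const_bound[where B=1]) (auto simp: norm_mult)
  have w: "0 \<le> ?w" "?w \<le> window_mass 0 H"
    using uv by (auto simp: window_mass_def intro!: window_mass_mono[unfolded window_mass_def])
  have fm: "?f \<in> borel_measurable time_marks"
    by measurable
  \<comment> \<open>The formula for complex sums takes one common bound for both functions, and the
    integrand needs 2.\<close>
  have Zb2: "norm (Z \<omega>) \<le> 2" for \<omega>
    using Zb[of \<omega>] by simp
  have X: "has_bochner_integral M (\<lambda>\<omega>. Z \<omega> * cpoint_sum u v ?f \<omega>) ((LINT \<omega>|M. Z \<omega>) * ?L)"
    unfolding char_exponent_def
    by (rule has_integral_points_complex[OF Z fm uv(1,3) Zb2 norm_iexp_minus_one_le])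
  \<comment> \<open>The linearisation error, almost surely at most four times
    \<open>pair_count\<close>.\<close>
  let ?R = "\<lambda>\<omega>. Z \<omega> * ?D \<omega> - Z \<omega> - Z \<omega> * cpoint_sum u v ?f \<omega>"
  have Xi: "integrable M (\<lambda>\<omega>. Z \<omega> * cpoint_sum u v ?f \<omega>)"
    and XE: "(LINT \<omega>|M. Z \<omega> * cpoint_sum u v ?f \<omega>) = (LINT \<omega>|M. Z \<omega>) * ?L"
    using X by (auto simp: has_bochner_integral_iff)
  have Ri: "integrable M ?R"
    by (intro Bochner_Integration.integrable_diff ZD Zi Xi)
  have "ennreal (norm (LINT \<omega>|M. ?R \<omega>)) \<le> (\<integral>\<^sup>+\<omega>. ennreal (norm (?R \<omega>)) \<partial>M)"
    using Ri by (rule integral_norm_bound_ennreal)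
  also have "\<dots> \<le> (\<integral>\<^sup>+\<omega>. ennreal (real (pair_count u v \<omega>)) * 4 \<partial>M)"
  proof (rule nn_integral_mono_AE, use AE_finite_points in eventually_elim)
    fix \<omega> assume fin: "finite {i. T i \<omega> \<le> H}"
    have "norm (?R \<omega>) = norm (Z \<omega>) * norm (?D \<omega> - 1 - cpoint_sum u v ?f \<omega>)"
      by (simp add: norm_mult[symmetric] algebra_simps)
    also have "\<dots> \<le> 1 * (4 * real (pair_count u v \<omega>))"
      using Zb exp_point_sum_approx[OF fin uv(3)] by (intro mult_mono) auto
    finally show "ennreal (norm (?R \<omega>)) \<le> ennreal (real (pair_count u v \<omega>)) * 4"
      using ennreal_mult''[of 4 "real (pair_count u v \<omega>)"] ennreal_leI[of "norm (?R \<omega>)" "4 * real (pair_count u v \<omega>)"]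
      by (simp add: mult.commute)
  qed
  also have "\<dots> \<le> ennreal (?w\<^sup>2) * 4"
    using nn_integral_pair_count_le[OF uv(1,3)] .
  also have "\<dots> = ennreal (4 * ?w\<^sup>2)"
    using ennreal_mult''[of 4 "?w\<^sup>2"] by (simp add: mult.commute)
  finally have "norm (LINT \<omega>|M. ?R \<omega>) \<le> 4 * ?w\<^sup>2"
    by simp
  moreover have "(LINT \<omega>|M. ?R \<omega>) = (LINT \<omega>|M. Z \<omega> * ?D \<omega>) - (LINT \<omega>|M. Z \<omega>) - (LINT \<omega>|M. Z \<omega>) * ?L"
    using ZD Zi Xi XE by simp
  ultimately have A: "norm ((LINT \<omega>|M. Z \<omega> * ?D \<omega>) - (LINT \<omega>|M. Z \<omega>) - (LINT \<omega>|M. Z \<omega>) * ?L) \<le> 4 * ?w\<^sup>2"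
    by simp
  have L: "norm ?L \<le> 2 * ?w"
    using norm_char_exponent_le[OF g uv(1,3)] .
  have "norm (LINT \<omega>|M. Z \<omega>) \<le> (LINT \<omega>|M. norm (Z \<omega>))"
    by (rule integral_norm_bound)
  also have "\<dots> \<le> (LINT \<omega>|M. 1)"
    using Zi Zb by (intro integral_mono) auto
  finally have EZ: "norm (LINT \<omega>|M. Z \<omega>) \<le> 1"
    by (simp add: prob_space)
  have "norm (exp ?L - 1 - ?L) \<le> exp \<bar>Re ?L\<bar> * (norm ?L)\<^sup>2"
    by (rule norm_exp_minus_one_minus_le)
  also have "\<dots> \<le> exp (2 * window_mass 0 H) * (2 * ?w)\<^sup>2"
    using L w abs_Re_le_cmod[of ?L] by (intro mult_mono power_mono) auto
  finally have E: "norm (exp ?L - 1 - ?L) \<le> 4 * exp (2 * window_mass 0 H) * ?w\<^sup>2"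
    by (simp add: power2_eq_square algebra_simps)
  let ?a = "(LINT \<omega>|M. Z \<omega> * ?D \<omega>) - (LINT \<omega>|M. Z \<omega>) - (LINT \<omega>|M. Z \<omega>) * ?L"
  have "(LINT \<omega>|M. Z \<omega> * ?D \<omega>) - (LINT \<omega>|M. Z \<omega>) * exp ?L = ?a - (LINT \<omega>|M. Z \<omega>) * (exp ?L - 1 - ?L)"
    by (simp add: algebra_simps)
  then have "norm ((LINT \<omega>|M. Z \<omega> * ?D \<omega>) - (LINT \<omega>|M. Z \<omega>) * exp ?L) \<le>
      norm ?a + norm ((LINT \<omega>|M. Z \<omega>) * (exp ?L - 1 - ?L))"
    by (simp only: norm_triangle_ineq4)
  also have "\<dots> \<le> 4 * ?w\<^sup>2 + norm (LINT \<omega>|M. Z \<omega>) * norm (exp ?L - 1 - ?L)"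
    using A by (simp only: norm_mult add_le_cancel_right)
  also have "\<dots> \<le> 4 * ?w\<^sup>2 + 1 * (4 * exp (2 * window_mass 0 H) * ?w\<^sup>2)"
    using EZ E by (intro add_mono mult_mono) auto
  finally show ?thesis
    by (simp add: algebra_simps)
qed

section \<open>From windows to the conditional expectation\<close>

lemma continuous_window_mass:
  assumes t: "0 \<le> t" and atoms: "\<forall>s\<in>{t<..H}. emeasure \<nu>\<^sub>0 ({s} \<times> UNIV) = 0"
  shows "continuous_on {t..H} (window_mass t)"
proof -
  note [measurable_cong] = sets_\<nu>\<^sub>0
  let ?W = "{t<..H} \<times> (UNIV :: (real ^ 'd) set)"
  let ?R = "restrict_space \<nu>\<^sub>0 ?W"
  \<comment> \<open>On \<open>{t..H}\<close>, \<open>window_mass t\<close> is the distribution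
    function of this finite measure on the line, and a distribution function is continuous exactly
    where there is no atom. Outside \<open>{t<..H}\<close> the restriction removes all mass.\<close>
  let ?N = "distr ?R borel fst"
  have W: "?W \<in> sets \<nu>\<^sub>0"
    using t by (rule window_sets)
  have fstR[measurable]: "fst \<in> ?R \<rightarrow>\<^sub>M borel"
    by (intro measurable_restrict_space1) measurable
  have spR: "space ?R = ?W"
    using sets.sets_into_space[OF W] by (auto simp: space_restrict_space)
  have R: "emeasure ?R (space ?R) \<noteq> \<infinity>"
    unfolding spR using W emeasure_window[OF t order_refl] by (simp add: emeasure_restrict_space)
  interpret N: finite_borel_measure ?N
  proof (intro finite_borel_measure.intro finite_measureI finite_borel_measure_axioms.intro)
    show "emeasure ?N (space ?N) \<noteq> \<infinity>"
      using R by (subst emeasure_distr) auto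
  qed simp
  have meas: "measure ?N B = measure \<nu>\<^sub>0 (B \<times> UNIV \<inter> ?W)" if "B \<in> sets borel" for B
  proof -
    have "fst -` B \<inter> space ?R = B \<times> UNIV \<inter> ?W"
      by (auto simp: spR)
    then show ?thesis
      using that W by (simp add: measure_distr measure_restrict_space)
  qed
  have "isCont (cdf ?N) x" for x
  proof -
    have "measure \<nu>\<^sub>0 ({x} \<times> UNIV \<inter> ?W) = 0"
    proof (cases "x \<in> {t<..H}")
      case True
      then have "{x} \<times> UNIV \<inter> ?W = {x} \<times> UNIV" by auto
      then show ?thesis using True atoms by (simp add: measure_def)
    next
      case False
      then have "{x} \<times> UNIV \<inter> ?W = {}" by auto
      then show ?thesis by simp
    qed
    then show ?thesis
      unfolding N.isCont_cdf by (simp add: meas)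
  qed
  then have "continuous_on {t..H} (cdf ?N)"
    by (simp add: continuous_at_imp_continuous_on)
  moreover have "cdf ?N v = window_mass t v" if "v \<in> {t..H}" for v
  proof -
    have "{..v} \<times> UNIV \<inter> ?W = {t<..v} \<times> UNIV"
      using that by auto
    then show ?thesis
      by (simp add: cdf_def2 meas window_mass_def)
  qed
  ultimately show ?thesis
    by (subst continuous_on_cong[OF refl, of _ _ "cdf ?N"]) auto
qed

lemma window_mass_diff:
  assumes "0 \<le> t" "t \<le> u" "u \<le> v" "v \<le> H"
  shows "window_mass u v = window_mass t v - window_mass t u"
proof -
  have "{u<..v} \<times> (UNIV :: (real ^ 'd) set) = {t<..v} \<times> UNIV - {t<..u} \<times> UNIV"
    using assms by auto
  moreover have "{t<..v} \<times> (UNIV :: (real ^ 'd) set) \<in> fmeasurable \<nu>\<^sub>0" "{t<..u} \<times> (UNIV :: (real ^ 'd) set) \<in> fmeasurable \<nu>\<^sub>0"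
    using assms by (auto simp: fmeasurable_def window_sets emeasure_window)
  ultimately show ?thesis
    unfolding window_mass_def using assms by (auto intro!: measurable_measure_Diff dest: fmeasurableD)
qed

text \<open>For every \<open>A\<close> in \<open>F t\<close> this is the integral identity that
  characterises the conditional expectation given \<open>F t\<close>. It compares the two end values
  of the function shown constant, the exponent over the empty window at \<open>H\<close> being
  0.\<close>

lemma char_restricted_expectation:
  assumes g[measurable]: "g \<in> borel_measurable time_marks" and t: "0 \<le> t" "t \<le> H"
    and atoms: "\<forall>s\<in>{t<..H}. emeasure \<nu>\<^sub>0 ({s} \<times> UNIV) = 0" and A: "A \<in> sets (F t)"
  shows "(LINT \<omega>|M. indicator A \<omega> * exp (\<i> * complex_of_real (point_sum 0 H g \<omega>))) =
    (LINT \<omega>|M. indicator A \<omega> * exp (\<i> * complex_of_real (point_sum 0 t g \<omega>))) * exp (char_exponent g t H)"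
proof -
  let ?Z = "\<lambda>u \<omega>. indicator A \<omega> * exp (\<i> * complex_of_real (point_sum 0 u g \<omega>)) :: complex"
  let ?\<phi> = "\<lambda>u. LINT \<omega>|M. ?Z u \<omega>"
  let ?\<Phi> = "\<lambda>u. ?\<phi> u * exp (char_exponent g u H)"
  let ?K = "exp (2 * window_mass 0 H)"
  let ?C = "4 + 4 * ?K"
  have [measurable]: "A \<in> sets M"
    using A sets_F_subset by auto
  have "?\<Phi> H = ?\<Phi> t"
  \<comment> \<open>\<open>?C\<close> is the constant of the one-window estimate and
    \<open>?K\<close> bounds the exponential factor of the remaining window from \<open>v\<close> to
    \<open>H\<close>.\<close>
  proof (rule constant_if_quadratic_modulus[where C="?C * ?K" and m="window_mass t"])
    show "continuous_on {t..H} (window_mass t)"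
      using t atoms by (intro continuous_window_mass)
    show "window_mass t t \<le> window_mass t H"
      using t by (intro window_mass_mono) auto
    fix u v assume tuv: "t \<le> u" "u \<le> v" "v \<le> H"
    then have uv: "0 \<le> u" "u \<le> v" "v \<le> H"
      using t by auto
    have Z: "?Z u \<in> borel_measurable (F u)"
    proof -
      have [measurable]: "A \<in> sets (F u)" "point_sum 0 u g \<in> borel_measurable (F u)"
        using A sets_F_mono[OF tuv(1)] point_sum_adapted[OF g] by auto
      show ?thesis by measurable
    qed
    have "?\<phi> v = (LINT \<omega>|M. ?Z u \<omega> * exp (\<i> * complex_of_real (point_sum u v g \<omega>)))"
    proof (rule integral_cong_AE)
      show "AE \<omega> in M. ?Z v \<omega> = ?Z u \<omega> * exp (\<i> * complex_of_real (point_sum u v g \<omega>))"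
        using AE_finite_points
        by eventually_elim (use uv in \<open>simp add: point_sum_add[of _ 0 u v] exp_add[symmetric] algebra_simps\<close>)
    qed measurable
    moreover have "norm (?Z u \<omega>) \<le> 1" for \<omega>
      by (simp add: norm_mult indicator_def)
    ultimately have *: "norm (?\<phi> v - ?\<phi> u * exp (char_exponent g u v)) \<le> ?C * (window_mass u v)\<^sup>2"
      using char_increment[OF Z _ g uv] by simp
    have "norm (exp (char_exponent g v H)) \<le> exp (norm (char_exponent g v H))"
      by (rule norm_exp)
    also have "\<dots> \<le> ?K"
      using norm_char_exponent_le[OF g, of v H] window_mass_mono[of 0 v H H] uv by simp
    finally have **: "norm (exp (char_exponent g v H)) \<le> ?K" .
    \<comment> \<open>Additivity of the exponent splits off the same last factor from both terms and
      leaves the one-window error.\<close>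
    have "?\<Phi> v - ?\<Phi> u = (?\<phi> v - ?\<phi> u * exp (char_exponent g u v)) * exp (char_exponent g v H)"
      by (simp only: char_exponent_add[OF g uv(1,2,3) order_refl] exp_add left_diff_distrib mult.assoc)
    then have "norm (?\<Phi> v - ?\<Phi> u) = norm (?\<phi> v - ?\<phi> u * exp (char_exponent g u v)) * norm (exp (char_exponent g v H))"
      by (simp only: norm_mult)
    also have "\<dots> \<le> (?C * (window_mass u v)\<^sup>2) * ?K"
      by (rule mult_mono[OF * **]) (simp_all add: add_nonneg_nonneg)
    also have "\<dots> = ?C * ?K * (window_mass t v - window_mass t u)\<^sup>2"
      by (simp only: window_mass_diff[OF t(1) tuv] mult_ac)
    finally show "norm (?\<Phi> v - ?\<Phi> u) \<le> ?C * ?K * (window_mass t v - window_mass t u)\<^sup>2" .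
  qed (use t in auto)
  moreover have "char_exponent g H H = 0"
    by (simp add: char_exponent_def set_lebesgue_integral_def)
  ultimately show ?thesis
    by simp
qed

text \<open>The integrals over sets of \<open>F t\<close> determine the real and imaginary parts
  separately. \<open>X\<close> is prescribed only almost surely, because \<theta> is moved into the
  point sum on outcomes with finitely many points up to \<open>H\<close>.\<close>

lemma complex_cond_exp_char:
  fixes X :: "'a \<Rightarrow> complex"
  assumes g[measurable]: "g \<in> borel_measurable time_marks" and t: "0 \<le> t" "t \<le> H"
    and atoms: "\<forall>s\<in>{t<..H}. emeasure \<nu>\<^sub>0 ({s} \<times> UNIV) = 0"
    and X[measurable]: "X \<in> borel_measurable M"
    and XH: "AE \<omega> in M. X \<omega> = exp (\<i> * complex_of_real (point_sum 0 H g \<omega>))"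
  shows "AE \<omega> in M. complex_cond_exp M (F t) X \<omega> =
    exp (\<i> * complex_of_real (point_sum 0 t g \<omega>)) * exp (char_exponent g t H)"
proof -
  let ?c = "exp (char_exponent g t H)"
  let ?V = "\<lambda>\<omega>. exp (\<i> * complex_of_real (point_sum 0 t g \<omega>)) * ?c"
  interpret S: sigma_finite_subalgebra M "F t"
    using subalgebra_F finite_measure_axioms
    by (intro finite_measure_subalgebra_is_sigma_finite)
      (simp add: finite_measure_subalgebra_def finite_measure_subalgebra_axioms_def)
  have [measurable]: "point_sum 0 t g \<in> borel_measurable (F t)"
    by (rule point_sum_adapted[OF g])
  have VF: "?V \<in> borel_measurable (F t)"
    by measurable
  then have VM[measurable]: "?V \<in> borel_measurable M"
    by (rule measurable_F_M)
  have Vi: "integrable M ?V"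
    by (intro integrable_const_bound[where B="norm ?c"] VM) (auto simp: norm_mult)
  have Xi: "integrable M X"
    using XH by (intro integrable_const_bound[where B=1] X) auto
  have set_eq: "(LINT \<omega>:A|M. X \<omega>) = (LINT \<omega>:A|M. ?V \<omega>)" if A: "A \<in> sets (F t)" for A
  proof -
    have AM[measurable]: "A \<in> sets M"
      using A sets_F_subset by auto
    have "(LINT \<omega>:A|M. X \<omega>) = (LINT \<omega>|M. indicator A \<omega> * exp (\<i> * complex_of_real (point_sum 0 H g \<omega>)))"
      unfolding set_lebesgue_integral_def
    proof (rule integral_cong_AE)
      show "AE \<omega> in M. indicator A \<omega> *\<^sub>R X \<omega> = indicator A \<omega> * exp (\<i> * complex_of_real (point_sum 0 H g \<omega>))"
        using XH by eventually_elim (simp add: indicator_def)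
    qed measurable
    also have "\<dots> = (LINT \<omega>|M. indicator A \<omega> * exp (\<i> * complex_of_real (point_sum 0 t g \<omega>))) * ?c"
      by (rule char_restricted_expectation[OF g t atoms A])
    also have "\<dots> = (LINT \<omega>|M. (indicator A \<omega> * exp (\<i> * complex_of_real (point_sum 0 t g \<omega>))) * ?c)"
      by simp
    also have "\<dots> = (LINT \<omega>:A|M. ?V \<omega>)"
      unfolding set_lebesgue_integral_def
      by (intro Bochner_Integration.integral_cong) (auto simp: indicator_def)
    finally show ?thesis .
  qed
  have AM: "A \<in> sets M" if "A \<in> sets (F t)" for A
    using that sets_F_subset by auto
  have Re_set: "(LINT \<omega>:A|M. Re (f \<omega>)) = Re (LINT \<omega>:A|M. f \<omega>)"
    and Im_set: "(LINT \<omega>:A|M. Im (f \<omega>)) = Im (LINT \<omega>:A|M. f \<omega>)"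
    if "integrable M f" "A \<in> sets (F t)" for f :: "'a \<Rightarrow> complex" and A
    using integral_Re[OF integrable_mult_indicator[OF AM[OF that(2)] that(1)]]
      integral_Im[OF integrable_mult_indicator[OF AM[OF that(2)] that(1)]]
    by (simp_all add: set_lebesgue_integral_def)
  have "AE \<omega> in M. real_cond_exp M (F t) (\<lambda>\<omega>. Re (X \<omega>)) \<omega> = Re (?V \<omega>)"
    using Xi Vi VF set_eq by (intro S.real_cond_exp_charact) (auto simp only: Re_set intro!: integrable_Re measurable_compose[OF _ borel_measurable_Re])
  moreover have "AE \<omega> in M. real_cond_exp M (F t) (\<lambda>\<omega>. Im (X \<omega>)) \<omega> = Im (?V \<omega>)"
    using Xi Vi VF set_eq by (intro S.real_cond_exp_charact) (auto simp only: Im_set intro!: integrable_Im measurable_compose[OF _ borel_measurable_Im])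
  ultimately show ?thesis
    by eventually_elim (simp only: complex_cond_exp_def complex.collapse)
qed

section \<open>Return to the jump measure and the shot noise\<close>

lemma integral_jump_measure_window:
  assumes h[measurable]: "h \<in> borel_measurable time_marks" and \<omega>: "\<omega> \<in> space M"
    and fin: "finite {i. T i \<omega> \<le> H}" and u: "0 \<le> u" "u \<le> H"
  shows "(LINT z:{0..u} \<times> UNIV|jump_measure T U \<omega>. h z) = point_sum 0 u h \<omega>"
proof -
  have W: "{0..u} \<times> UNIV \<in> sets (time_marks :: (real \<times> (real ^ 'd)) measure)"
    using closed_window_sets[of u] by (simp add: sets_\<nu>\<^sub>0)
  let ?k = "\<lambda>i. indicator ({0..u} \<times> UNIV) (T i \<omega>, U i \<omega>) *\<^sub>R h (T i \<omega>, U i \<omega>)"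
  \<comment> \<open>Jump times are positive, so closing the window at 0 adds no point.\<close>
  let ?J = "{i. 0 < T i \<omega> \<and> T i \<omega> \<le> u}"
  have J: "finite ?J"
    using u by (intro finite_subset[OF _ fin]) auto
  have k: "?k i = (if i \<in> ?J then h (T i \<omega>, U i \<omega>) else 0)" for i
    using T_pos[OF \<omega>, of i] by (auto simp: indicator_def)
  have "(\<lambda>i. (T i \<omega>, U i \<omega>)) \<in> count_space UNIV \<rightarrow>\<^sub>M (time_marks :: (real \<times> (real ^ 'd)) measure)"
    using T_pos[OF \<omega>] by (auto simp: space_time_marks less_imp_le)
  then have "(LINT z:{0..u} \<times> UNIV|jump_measure T U \<omega>. h z) = (LINT i|count_space UNIV. ?k i)"
    unfolding jump_measure_def set_lebesgue_integral_def by (intro integral_distr borel_measurable_scaleR borel_measurable_indicator W h) simp_all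
  also have "\<dots> = (\<Sum>i. ?k i)"
  proof (rule integral_count_space_nat)
    show "integrable (count_space UNIV) ?k"
      unfolding integrable_count_space_nat_iff k by (rule summable_finite[OF J]) auto
  qed
  also have "\<dots> = (\<Sum>i\<in>?J. ?k i)"
    unfolding k using J by (intro suminf_finite) auto
  also have "\<dots> = point_sum 0 u h \<omega>"
    unfolding k using fin u by (simp add: point_sum_eq)
  finally show ?thesis .
qed

end

text \<open>At a fixed time \<open>s\<close> with an atom of \<open>\<nu>\<^sub>0\<close> at most
  one point can fall, and the exact factor there is one plus the integral of
  \<open>exp (\<i> * \<theta> * G (H - s) x) - 1\<close> over the atom, not its exponential.
  Excluding atoms in \<open>{t<..H}\<close> rules such factors out.\<close>

theorem proposition2p4:
  fixes M :: "'a measure" and F :: "real \<Rightarrow> 'a measure"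
    and T :: "nat \<Rightarrow> 'a \<Rightarrow> real" and U :: "nat \<Rightarrow> 'a \<Rightarrow> real ^ 'd"
    and \<nu> :: "'a \<Rightarrow> (real \<times> (real ^ 'd)) measure" and \<nu>\<^sub>0 :: "(real \<times> (real ^ 'd)) measure"
    and G :: "real \<Rightarrow> real ^ 'd \<Rightarrow> real" and H t \<theta> :: real
  assumes "usual_filtered_prob_space M F"
    and "marked_point_process M F T U"
    and "compensator M F (jump_measure T U) \<nu>"
    and "(\<lambda>(s, x). G s x) \<in> borel_measurable time_marks"
    and "shot_noise_converges M G T U"
    and "\<forall>\<omega>\<in>space M. \<nu> \<omega> = \<nu>\<^sub>0"
    and "emeasure \<nu>\<^sub>0 ({0..H} \<times> UNIV) < \<infinity>"
    and "\<forall>s\<in>{t<..H}. emeasure \<nu>\<^sub>0 ({s} \<times> UNIV) = 0"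
    and "0 \<le> t" and "t \<le> H"
  shows "AE \<omega> in M.
    complex_cond_exp M (F t) (\<lambda>\<omega>. exp (\<i> * \<theta> * shot_noise G T U H \<omega>)) \<omega> =
      exp (\<i> * \<theta> * (LINT (s, x) : {0..t} \<times> UNIV | jump_measure T U \<omega>. G (H - s) x)) *
      exp (LINT (s, x) : {t<..H} \<times> UNIV | \<nu>\<^sub>0. (exp (\<i> * \<theta> * G (H - s) x) - 1))"
proof -
  interpret P: usual_filtered_prob_space M F
    by fact
  \<comment> \<open>\<open>\<nu>\<^sub>0\<close> is given through its equality with
    \<open>\<nu>\<close> at outcomes, so reading off its sigma-field takes one outcome.\<close>
  obtain \<omega>\<^sub>0 where \<omega>\<^sub>0: "\<omega>\<^sub>0 \<in> space M"
    using P.not_empty by auto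
  interpret deterministic_compensator M F T U \<nu>\<^sub>0 H
  proof
    show "sets \<nu>\<^sub>0 = sets time_marks"
      using assms(3,6) \<omega>\<^sub>0 by (auto simp: compensator_def predictable_random_measure_def)
    fix W :: "('a \<times> real) \<times> (real ^ 'd) \<Rightarrow> ennreal"
    assume "W \<in> borel_measurable (predictable_sigma M F \<Otimes>\<^sub>M borel)"
    then have "(\<integral>\<^sup>+\<omega>. (\<integral>\<^sup>+(s, x). W ((\<omega>, s), x) \<partial>jump_measure T U \<omega>) \<partial>M) =
        (\<integral>\<^sup>+\<omega>. (\<integral>\<^sup>+(s, x). W ((\<omega>, s), x) \<partial>\<nu> \<omega>) \<partial>M)"
      using assms(3) by (simp add: compensator_def)
    also have "\<dots> = (\<integral>\<^sup>+\<omega>. (\<integral>\<^sup>+(s, x). W ((\<omega>, s), x) \<partial>\<nu>\<^sub>0) \<partial>M)"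
      using assms(6) by (intro nn_integral_cong) simp
    finally show "(\<integral>\<^sup>+\<omega>. (\<integral>\<^sup>+(s, x). W ((\<omega>, s), x) \<partial>jump_measure T U \<omega>) \<partial>M) =
        (\<integral>\<^sup>+\<omega>. (\<integral>\<^sup>+(s, x). W ((\<omega>, s), x) \<partial>\<nu>\<^sub>0) \<partial>M)" .
  qed fact+
  \<comment> \<open>Extending by zero after \<open>H\<close> gives a function on all non-negative
    times and leaves every window up to \<open>H\<close> unchanged.\<close>
  let ?k = "\<lambda>z :: real \<times> (real ^ 'd). if fst z \<le> H then G (H - fst z) (snd z) else 0"
  let ?g = "\<lambda>z. \<theta> * ?k z"
  have k[measurable]: "?k \<in> borel_measurable time_marks"
    using assms(4) by (rule time_reversal_measurable)
  have g: "?g \<in> borel_measurable time_marks"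
    by measurable
  have shot: "shot_noise G T U H \<omega> = point_sum 0 H ?k \<omega>" if "\<omega> \<in> space M" for \<omega>
    unfolding shot_noise_def point_sum_def using T_pos[OF that]
    by (intro suminf_cong) (auto simp: indicator_def)
  have "shot_noise G T U H \<in> borel_measurable M"
    using point_sum_measurable[OF k] by (rule measurable_cong[THEN iffD1, rotated]) (simp add: shot)
  then have X: "(\<lambda>\<omega>. exp (\<i> * \<theta> * shot_noise G T U H \<omega>)) \<in> borel_measurable M"
    by measurable
  \<comment> \<open>With finitely many points both series are finite sums, so \<theta> factors
    out.\<close>
  have scale: "point_sum 0 u ?g \<omega> = \<theta> * point_sum 0 u ?k \<omega>" if "finite {i. T i \<omega> \<le> H}" "u \<le> H" for u \<omega>
    using that by (simp only: point_sum_eq sum_distrib_left)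
  have XH: "AE \<omega> in M. exp (\<i> * \<theta> * shot_noise G T U H \<omega>) = exp (\<i> * complex_of_real (point_sum 0 H ?g \<omega>))"
    using AE_finite_points AE_space by eventually_elim (simp only: shot scale order_refl of_real_mult mult.assoc)
  have exponent: "char_exponent ?g t H =
      (LINT (s, x) : {t<..H} \<times> UNIV | \<nu>\<^sub>0. (exp (\<i> * \<theta> * G (H - s) x) - 1))"
    unfolding char_exponent_def using window_sets[OF assms(9)]
    by (intro set_lebesgue_integral_cong) (auto simp: mult.assoc)
  from AE_finite_points AE_space complex_cond_exp_char[OF g assms(9,10,8) X XH]
  show ?thesis
  proof eventually_elim
    case (elim \<omega>)
    have "{0..t} \<times> UNIV \<in> sets (jump_measure T U \<omega>)"
      using closed_window_sets[of t] by (simp add: jump_measure_def sets_\<nu>\<^sub>0)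
    then have "(LINT (s, x) : {0..t} \<times> UNIV | jump_measure T U \<omega>. G (H - s) x) =
        (LINT z : {0..t} \<times> UNIV | jump_measure T U \<omega>. ?k z)"
      using assms(10) by (intro set_lebesgue_integral_cong) auto
    also have "\<dots> = point_sum 0 t ?k \<omega>"
      using elim assms(9,10) by (intro integral_jump_measure_window k) auto
    finally have "complex_of_real (point_sum 0 t ?g \<omega>) =
        \<theta> * (LINT (s, x) : {0..t} \<times> UNIV | jump_measure T U \<omega>. G (H - s) x)"
      using scale[OF elim(1) assms(10)] by simp
    then show ?case
      using elim(3) by (simp only: exponent mult.assoc of_real_mult)
  qed
qed

end
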